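(* Let $s,t\ge 1$ be integers. Every Oeljeklaus–Toma manifold $X(K,U)$ of type $(s,t)$ does not admit any symplectic form taming its complex structure.
   Context: Oeljeklaus–Toma manifolds. Let $K$ be a finite extension field of $\mathbb{Q}$ of degree $s+2t$ with $s,t$ positive integers, admitting embeddings $\sigma_1,\dots,\sigma_s,\sigma_{s+1},\dots,\sigma_{s+2t}$ into $\mathbb{C}$ such that $\sigma_1,\dots,\sigma_s$ are real embeddings and $\sigma_{s+1},\dots,\sigma_{s+2t}$ are complex (non-real) ones with $\sigma_{s+i}=\overline{\sigma_{s+i+t}}$ for $1\le i\le t$. Let $\mathcal{O}_K$ be the ring of algebraic integers of $K$, $\mathcal{O}_K^{*}$ its group of units, and $$\mathcal{O}_K^{*,+}=\{a\in\mathcal{O}_K^{*}:\ \sigma_i(a)>0\ \text{for all } 1\le i\le s\}.$$ Define $l:\mathcal{O}_K^{*,+}\to\mathbb{R}^{s+t}$ by $$l(a)=(\log|\sigma_1(a)|,\dots,\log|\sigma_s(a)|,2\log|\sigma_{s+1}(a)|,\dots,2\log|\sigma_{s+t}(a)|).$$ By Dirichlet's unit theorem $l(\mathcal{O}_K^{*,+})$ is a lattice in $L=\{x\in\mathbb{R}^{s+t}:\sum_{i=1}^{s+t}x_i=0\}$. Let $p:L\to\mathbb{R}^s$ be the projection onto the first $s$ coordinates, and let $U\subset\mathcal{O}_K^{*,+}$ be a subgroup of rank $s$ such that $p(l(U))$ is a lattice in $\mathbb{R}^s$ (such subgroups exist). Let $H$ be the upper half plane in $\mathbb{C}$. The group $U\ltimes\mathcal{O}_K$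 acts on $H^s\times\mathbb{C}^t$ by $$(a,b)\cdot(w_1,\dots,w_s,z_1,\dots,z_t)=(\sigma_1(a)w_1+\sigma_1(b),\dots,\sigma_s(a)w_s+\sigma_s(b),\sigma_{s+1}(a)z_1+\sigma_{s+1}(b),\dots,\sigma_{s+t}(a)z_t+\sigma_{s+t}(b)).$$ The quotient $X(K,U)=(H^s\times\mathbb{C}^t)/(U\ltimes\mathcal{O}_K)$ is a compact complex manifold, called an Oeljeklaus–Toma manifold of type $(s,t)$; its complex structure is the one induced from $H^s\times\mathbb{C}^t$. A symplectic form $\Omega$ on a complex manifold $(M,J)$ tames $J$ if $\Omega(X,JX)>0$ for every nonzero tangent vector $X$. *)

theory Defs
  imports "HOL-Analysis.Analysis" "HOL-Computational_Algebra.Computational_Algebra"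
begin

section \<open>Complex manifolds, differential 2-forms, taming symplectic forms\<close>

text \<open>
  A chart is a pair of its domain and its coordinate map.  A complex manifold is given by its
  points, a holomorphic atlas, and the complex structure of the model space (multiplication by the
  imaginary unit, as a real-linear map).  As the transition maps are holomorphic, the almost
  complex structure on tangent vectors is this multiplication in the coordinates of every chart;
  the topology is the one for which the charts are homeomorphisms onto open sets.
\<close>

type_synonym ('m, 'e) chart = "'m set \<times> ('m \<Rightarrow> 'e)"

record ('m, 'e) complex_mfd =
  points :: "'m set"
  atlas :: "('m, 'e) chart set"
  model_J :: "'e \<Rightarrow> 'e"

definition charts_at :: "('m, 'e) complex_mfd \<Rightarrow> 'm \<Rightarrow> ('m, 'e) chart set" where
  "charts_at M p = {c \<in> atlas M. p \<in> fst c}"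

definition transition :: "('m, 'e) chart \<Rightarrow> ('m, 'e) chart \<Rightarrow> 'e \<Rightarrow> 'e" where
  "transition c d = snd d \<circ> inv_into (fst c) (snd c)"

text \<open>
  On an open set of a Euclidean space, a function is of class \<open>C^(k+1)\<close> iff it is differentiable
  and all its directional derivatives are of class \<open>C^k\<close>.
\<close>

primrec Ck_on ::
  "nat \<Rightarrow> 'e::euclidean_space set \<Rightarrow> ('e \<Rightarrow> 'f::real_normed_vector) \<Rightarrow> bool" where
  "Ck_on 0 S f \<longleftrightarrow> continuous_on S f"
| "Ck_on (Suc k) S f \<longleftrightarrow> (\<forall>x\<in>S. f differentiable (at x)) \<and>
     (\<forall>v. Ck_on k S (\<lambda>x. frechet_derivative f (at x) v))"

definition smooth_on ::
  "'e::euclidean_space set \<Rightarrow> ('e \<Rightarrow> 'f::real_normed_vector) \<Rightarrow> bool" where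
  "smooth_on S f \<longleftrightarrow> (\<forall>k. Ck_on k S f)"

text \<open>
  A differential 2-form is a family of local forms, one for each chart, that agree under the
  transition maps: \<open>\<Omega> c x u v\<close> is the value, at the point with coordinates \<open>x\<close> in the chart \<open>c\<close>,
  on the tangent vectors with coordinates \<open>u\<close> and \<open>v\<close>.
\<close>

type_synonym ('m, 'e) form2 = "('m, 'e) chart \<Rightarrow> 'e \<Rightarrow> 'e \<Rightarrow> 'e \<Rightarrow> real"

definition differential_2_form ::
  "('m, 'e::euclidean_space) complex_mfd \<Rightarrow> ('m, 'e) form2 \<Rightarrow> bool" where
  "differential_2_form M \<Omega> \<longleftrightarrow>
     (\<forall>p\<in>points M. \<forall>c\<in>charts_at M p.
        bilinear (\<Omega> c (snd c p)) \<and> (\<forall>u. \<Omega> c (snd c p) u u = 0)) \<and>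
     (\<forall>p\<in>points M. \<forall>c\<in>charts_at M p. \<forall>d\<in>charts_at M p. \<forall>u v.
        \<Omega> c (snd c p) u v =
        \<Omega> d (snd d p) (frechet_derivative (transition c d) (at (snd c p)) u)
                       (frechet_derivative (transition c d) (at (snd c p)) v)) \<and>
     (\<forall>c\<in>atlas M. \<forall>u v. smooth_on (snd c ` fst c) (\<lambda>x. \<Omega> c x u v))"

text \<open>The exterior derivative of a 2-form on an open set of the model space, evaluated on constant
  vector fields (which commute).\<close>

definition ext_deriv2 ::
  "('e::euclidean_space \<Rightarrow> 'e \<Rightarrow> 'e \<Rightarrow> real) \<Rightarrow> 'e \<Rightarrow> 'e \<Rightarrow> 'e \<Rightarrow> 'e \<Rightarrow> real" where
  "ext_deriv2 \<omega> x u v w =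
     frechet_derivative (\<lambda>y. \<omega> y v w) (at x) u
   - frechet_derivative (\<lambda>y. \<omega> y u w) (at x) v
   + frechet_derivative (\<lambda>y. \<omega> y u v) (at x) w"

definition symplectic_form ::
  "('m, 'e::euclidean_space) complex_mfd \<Rightarrow> ('m, 'e) form2 \<Rightarrow> bool" where
  "symplectic_form M \<Omega> \<longleftrightarrow>
     differential_2_form M \<Omega> \<and>
     (\<forall>p\<in>points M. \<forall>c\<in>charts_at M p. \<forall>u v w. ext_deriv2 (\<Omega> c) (snd c p) u v w = 0) \<and>
     (\<forall>p\<in>points M. \<forall>c\<in>charts_at M p. \<forall>u. u \<noteq> 0 \<longrightarrow> (\<exists>v. \<Omega> c (snd c p) u v \<noteq> 0))"

definition tames ::
  "('m, 'e::euclidean_space) complex_mfd \<Rightarrow> ('m, 'e) form2 \<Rightarrow> bool" where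
  "tames M \<Omega> \<longleftrightarrow>
     (\<forall>p\<in>points M. \<forall>c\<in>charts_at M p. \<forall>u. u \<noteq> 0 \<longrightarrow> \<Omega> c (snd c p) u (model_J M u) > 0)"


section \<open>Number fields and their units\<close>

text \<open>The degree over the rationals; it is 0 for an infinite extension.\<close>

definition degree_over_rat :: "'k::field_char_0 itself \<Rightarrow> nat" where
  "degree_over_rat _ = vector_space.dim (\<lambda>(q::rat) (x::'k). of_rat q * x) UNIV"

definition field_embedding :: "('k::field_char_0 \<Rightarrow> complex) \<Rightarrow> bool" where
  "field_embedding f \<longleftrightarrow>
     f 1 = 1 \<and> (\<forall>x y. f (x + y) = f x + f y) \<and> (\<forall>x y. f (x * y) = f x * f y)"

text \<open>
  The embeddings are indexed by \<open>'s + ('t + 't)\<close>, with \<open>CARD('s)\<close> and \<open>CARD('t)\<close> the numbers \<open>s\<close>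
  and \<open>t\<close> (positive, as types are nonempty): \<open>Inl i\<close> stands for the index \<open>i\<close> of a real
  embedding, \<open>Inr (Inl j)\<close> for \<open>s + j\<close>, and \<open>Inr (Inr j)\<close> for \<open>s + j + t\<close>.
\<close>

definition number_field_embeddings ::
  "('s::finite + ('t::finite + 't) \<Rightarrow> 'k::field_char_0 \<Rightarrow> complex) \<Rightarrow> bool" where
  "number_field_embeddings \<sigma> \<longleftrightarrow>
     degree_over_rat TYPE('k) = CARD('s) + 2 * CARD('t) \<and>
     inj \<sigma> \<and> (\<forall>n. field_embedding (\<sigma> n)) \<and>
     (\<forall>i. range (\<sigma> (Inl i)) \<subseteq> \<real>) \<and>
     (\<forall>j. \<not> range (\<sigma> (Inr j)) \<subseteq> \<real>) \<and>
     (\<forall>j x. \<sigma> (Inr (Inl j)) x = cnj (\<sigma> (Inr (Inr j)) x))"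

definition ring_of_integers :: "'k::field_char_0 set" where
  "ring_of_integers = {x. algebraic_int x}"

definition integer_units :: "'k::field_char_0 set" where
  "integer_units = {a. a \<in> ring_of_integers \<and> (\<exists>b\<in>ring_of_integers. a * b = 1)}"

definition positive_units ::
  "('s + ('t + 't) \<Rightarrow> 'k::field_char_0 \<Rightarrow> complex) \<Rightarrow> 'k set" where
  "positive_units \<sigma> = {a \<in> integer_units. \<forall>i. Re (\<sigma> (Inl i) a) > 0}"

definition log_map ::
  "('s::finite + ('t::finite + 't) \<Rightarrow> 'k::field_char_0 \<Rightarrow> complex) \<Rightarrow> 'k \<Rightarrow> real ^ ('s + 't)" where
  "log_map \<sigma> a = (\<chi> n. case n of
       Inl i \<Rightarrow> ln (cmod (\<sigma> (Inl i) a))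
     | Inr j \<Rightarrow> 2 * ln (cmod (\<sigma> (Inr (Inl j)) a)))"

definition proj_real :: "real ^ ('s::finite + 't::finite) \<Rightarrow> real ^ 's" where
  "proj_real x = (\<chi> i. x $ Inl i)"

definition is_lattice :: "'v::euclidean_space set \<Rightarrow> bool" where
  "is_lattice \<Lambda> \<longleftrightarrow>
     0 \<in> \<Lambda> \<and> (\<forall>x\<in>\<Lambda>. \<forall>y\<in>\<Lambda>. x - y \<in> \<Lambda>) \<and> discrete \<Lambda> \<and> span \<Lambda> = UNIV"

definition mult_subgroup :: "'k::field set \<Rightarrow> 'k set \<Rightarrow> bool" where
  "mult_subgroup U G \<longleftrightarrow>
     U \<subseteq> G \<and> 1 \<in> U \<and> (\<forall>a\<in>U. \<forall>b\<in>U. a * b \<in> U) \<and> (\<forall>a\<in>U. inverse a \<in> U)"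

definition mult_independent :: "'k::field set \<Rightarrow> bool" where
  "mult_independent B \<longleftrightarrow>
     finite B \<and> (\<forall>n::'k \<Rightarrow> int. (\<Prod>b\<in>B. b powi n b) = 1 \<longrightarrow> (\<forall>b\<in>B. n b = 0))"

definition has_mult_rank :: "'k::field set \<Rightarrow> nat \<Rightarrow> bool" where
  "has_mult_rank U r \<longleftrightarrow>
     (\<exists>B\<subseteq>U. mult_independent B \<and> card B = r) \<and>
     (\<forall>B\<subseteq>U. mult_independent B \<longrightarrow> card B \<le> r)"

definition admissible_units ::
  "('s::finite + ('t::finite + 't) \<Rightarrow> 'k::field_char_0 \<Rightarrow> complex) \<Rightarrow> 'k set \<Rightarrow> bool" where
  "admissible_units \<sigma> U \<longleftrightarrow>
     mult_subgroup U (positive_units \<sigma>) \<and> has_mult_rank U CARD('s) \<and>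
     is_lattice (proj_real ` log_map \<sigma> ` U)"


section \<open>Oeljeklaus--Toma manifolds\<close>

type_synonym ('s, 't) cover = "(complex ^ 's) \<times> (complex ^ 't)"

definition OT_cover :: "('s::finite, 't::finite) cover set" where
  "OT_cover = {(w, z). \<forall>i. Im (w $ i) > 0}"

definition OT_action ::
  "('s::finite + ('t::finite + 't) \<Rightarrow> 'k::field_char_0 \<Rightarrow> complex)
     \<Rightarrow> 'k \<times> 'k \<Rightarrow> ('s, 't) cover \<Rightarrow> ('s, 't) cover" where
  "OT_action \<sigma> = (\<lambda>(a, b) (w, z).
     ((\<chi> i. \<sigma> (Inl i) a * w $ i + \<sigma> (Inl i) b),
      (\<chi> j. \<sigma> (Inr (Inl j)) a * z $ j + \<sigma> (Inr (Inl j)) b)))"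

definition OT_orbit_rel ::
  "('s::finite + ('t::finite + 't) \<Rightarrow> 'k::field_char_0 \<Rightarrow> complex) \<Rightarrow> 'k set
     \<Rightarrow> (('s, 't) cover \<times> ('s, 't) cover) set" where
  "OT_orbit_rel \<sigma> U =
     {(x, y). x \<in> OT_cover \<and> y \<in> OT_cover \<and>
        (\<exists>g \<in> U \<times> ring_of_integers. y = OT_action \<sigma> g x)}"

definition OT_proj ::
  "('s::finite + ('t::finite + 't) \<Rightarrow> 'k::field_char_0 \<Rightarrow> complex) \<Rightarrow> 'k set
     \<Rightarrow> ('s, 't) cover \<Rightarrow> ('s, 't) cover set" where
  "OT_proj \<sigma> U x = OT_orbit_rel \<sigma> U `` {x}"

text \<open>
  The quotient with the complex structure induced from the cover: the charts are the inverses of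
  the projection on the open sets on which it is injective.  Since the action is free and properly
  discontinuous, these sets cover; the projection is open for the quotient topology.
\<close>

definition OT_manifold ::
  "('s::finite + ('t::finite + 't) \<Rightarrow> 'k::field_char_0 \<Rightarrow> complex) \<Rightarrow> 'k set
     \<Rightarrow> (('s, 't) cover set, ('s, 't) cover) complex_mfd" where
  "OT_manifold \<sigma> U =
     \<lparr> points = OT_cover // OT_orbit_rel \<sigma> U,
       atlas = {(OT_proj \<sigma> U ` V, inv_into V (OT_proj \<sigma> U)) | V.
                  open V \<and> V \<subseteq> OT_cover \<and> inj_on (OT_proj \<sigma> U) V},
       model_J = (\<lambda>(w, z). ((\<chi> i. \<i> * w $ i), (\<chi> j. \<i> * z $ j))) \<rparr>"

end

theory Submission
  imports Defs "Jordan_Normal_Form.Char_Poly"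
begin

text \<open>
  Pull a taming symplectic form back to a closed invariant form \<open>\<omega>\<close> on the cover.  Units have norm 1 and
  \<open>p(l(U))\<close> spans \<open>\<real>\<^sup>s\<close>, so some \<open>u \<in> U\<close> has \<open>\<bar>\<sigma>(u)\<bar> > 1\<close> for a complex embedding \<open>\<sigma>\<close>.
  Let \<open>e\<close> be the unit vector of the corresponding coordinate, and \<open>f = \<omega>(e, Je) > 0\<close>.  By
  invariance under the translations by integers, whose real span is \<open>\<real>\<^sup>s \<times> \<complex>\<^sup>t\<close>, the function
  \<open>f\<close> lies between positive constants on each level of the imaginary parts of the upper half plane
  coordinates; the action of \<open>u\<^sup>-\<^sup>N\<close> multiplies \<open>f\<close> by \<open>\<bar>\<sigma>(u)\<bar>\<^sup>2\<^sup>N\<close>.  Since \<open>\<omega>\<close> is closed, the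
  average of \<open>f\<close> over large squares in the plane of \<open>e\<close> and \<open>Je\<close> does not depend on the level: the
  derivative of the integral over a square of side \<open>R\<close> is a boundary term of size \<open>O(R)\<close>.  This
  is a contradiction for large \<open>N\<close>.
\<close>

section \<open>Algebraic integers\<close>

text \<open>The subgroup generated by the family. Integrality is tested below by multiplication
  preserving such a finitely generated group.\<close>

definition int_span :: "'i set \<Rightarrow> ('i \<Rightarrow> 'a::comm_ring_1) \<Rightarrow> 'a set" where
  "int_span I v = range (\<lambda>c::'i \<Rightarrow> int. \<Sum>i\<in>I. of_int (c i) * v i)"

lemma int_span_base: "finite I \<Longrightarrow> i \<in> I \<Longrightarrow> v i \<in> int_span I v"
  unfolding int_span_def
  by (rule range_eqI[of _ _ "\<lambda>j. if j = i then 1 else 0"])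
     (simp add: if_distrib[where f = of_int] if_distrib[where f = "\<lambda>c. c * v j" for j] cong: if_cong)

lemma int_span_add: "x \<in> int_span I v \<Longrightarrow> y \<in> int_span I v \<Longrightarrow> x + y \<in> int_span I v"
proof -
  assume "x \<in> int_span I v" "y \<in> int_span I v"
  then obtain c d where "x = (\<Sum>i\<in>I. of_int (c i) * v i)" "y = (\<Sum>i\<in>I. of_int (d i) * v i)"
    unfolding int_span_def by blast
  then have "x + y = (\<Sum>i\<in>I. of_int (c i + d i) * v i)"
    by (simp add: sum.distrib algebra_simps)
  then show ?thesis unfolding int_span_def by (intro range_eqI[where x = "\<lambda>i. c i + d i"])
qed

lemma int_span_scale: "x \<in> int_span I v \<Longrightarrow> of_int n * x \<in> int_span I v"
proof -
  assume "x \<in> int_span I v"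
  then obtain c where "x = (\<Sum>i\<in>I. of_int (c i) * v i)"
    unfolding int_span_def by blast
  then have "of_int n * x = (\<Sum>i\<in>I. of_int (n * c i) * v i)"
    by (simp add: sum_distrib_left algebra_simps)
  then show ?thesis unfolding int_span_def by (intro range_eqI[where x = "\<lambda>i. n * c i"])
qed

lemma int_span_0: "0 \<in> int_span I v"
  unfolding int_span_def by (rule range_eqI[of _ _ "\<lambda>_. 0"]) simp

lemma int_span_sum: "(\<And>j. j \<in> J \<Longrightarrow> f j \<in> int_span I v) \<Longrightarrow> sum f J \<in> int_span I v"
  by (induction J rule: infinite_finite_induct) (auto simp: int_span_0 intro: int_span_add)

lemma int_span_mult:
  assumes "\<And>i. i \<in> I \<Longrightarrow> x * v i \<in> int_span I v" and "y \<in> int_span I v"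
  shows "x * y \<in> int_span I v"
proof -
  obtain c where "y = (\<Sum>i\<in>I. of_int (c i) * v i)"
    using assms(2) unfolding int_span_def by blast
  then have "x * y = (\<Sum>i\<in>I. of_int (c i) * (x * v i))"
    by (simp add: sum_distrib_left algebra_simps)
  then show ?thesis by (auto intro!: int_span_sum int_span_scale assms(1))
qed

text \<open>Determinant trick: multiplication by \<open>x\<close> is expressed on the generators by
  an integer matrix, of which the vector of the generators is an eigenvector with eigenvalue
  \<open>x\<close>. Hence \<open>x\<close> is a root of the characteristic polynomial, which is
  monic with integer coefficients.\<close>

lemma algebraic_int_if_stable:
  fixes x :: "'a::field_char_0"
  assumes fin: "finite I" and nz: "i0 \<in> I" "v i0 \<noteq> 0"
    and st: "\<And>i. i \<in> I \<Longrightarrow> x * v i \<in> int_span I v"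
  shows "algebraic_int x"
proof -
  obtain c :: "'b \<Rightarrow> 'b \<Rightarrow> int" where c: "\<And>i. i \<in> I \<Longrightarrow> x * v i = (\<Sum>j\<in>I. of_int (c i j) * v j)"
    using st unfolding int_span_def image_iff by metis
  define n where "n = card I"
  obtain h where h: "bij_betw h {0..<n} I"
    using ex_bij_betw_nat_finite[OF fin] unfolding n_def by blast
  define A where "A = mat n n (\<lambda>(i,j). c (h i) (h j))"
  define w where "w = Matrix.vec n (\<lambda>i. v (h i))"
  have A: "A \<in> carrier_mat n n" and A': "map_mat of_int A \<in> carrier_mat n n"
    by (auto simp: A_def)
  obtain k where k: "k < n" "h k = i0"
    using h nz(1) by (metis atLeastLessThan_iff bij_betw_iff_bijections)
  \<comment> \<open>One nonzero generator suffices for \<open>w\<close> to be a genuine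
    eigenvector.\<close>
  have wnz: "w \<noteq> 0\<^sub>v n"
  proof
    assume "w = 0\<^sub>v n"
    then have "vec_index w k = vec_index (0\<^sub>v n) k" by simp
    then show False using k nz by (simp add: w_def)
  qed
  have "map_mat of_int A *\<^sub>v w = x \<cdot>\<^sub>v w"
  proof (rule eq_vecI)
    fix i assume "i < dim_vec (x \<cdot>\<^sub>v w)"
    then have i: "i < n" by (simp add: w_def)
    then have "h i \<in> I" using h by (auto simp: bij_betw_def)
    have "vec_index (map_mat of_int A *\<^sub>v w) i = (\<Sum>j\<in>{0..<n}. of_int (c (h i) (h j)) * v (h j))"
      using i by (simp add: A_def w_def scalar_prod_def)
    also have "\<dots> = (\<Sum>j\<in>I. of_int (c (h i) j) * v j)"
      using sum.reindex_bij_betw[OF h] .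
    finally show "vec_index (map_mat of_int A *\<^sub>v w) i = vec_index (x \<cdot>\<^sub>v w) i"
      using i c[OF \<open>h i \<in> I\<close>] by (simp add: w_def)
  qed (simp add: A_def w_def)
  then have "eigenvalue (map_mat of_int A) x"
    unfolding eigenvalue_def eigenvector_def using wnz A' by (intro exI[of _ w]) (auto simp: w_def)
  then have "poly (map_poly of_int (char_poly A)) x = 0"
    by (simp add: eigenvalue_root_char_poly[OF A'] of_int_hom.char_poly_hom[OF A])
  moreover have "lead_coeff (char_poly A) = 1"
    using degree_monic_char_poly[OF A] by simp
  ultimately show ?thesis
    unfolding algebraic_int_altdef_ipoly by blast
qed

lemma algebraic_int_power_eq:
  fixes x :: "'a::field_char_0"
  assumes "algebraic_int x"
  obtains m a where "m > 0" "x ^ m = (\<Sum>k<m. of_int (a k) * x ^ k)"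
proof -
  obtain p where p: "poly (map_poly of_int p) x = 0" "lead_coeff p = 1"
    using assms unfolding algebraic_int_altdef_ipoly by blast
  have deg: "degree (map_poly of_int p :: 'a poly) = degree p"
    by (rule degree_map_poly) (use p(2) in auto)
  have "poly (map_poly of_int p) x = (\<Sum>i\<le>degree p. of_int (coeff p i) * x ^ i)"
    by (simp add: poly_altdef deg coeff_map_poly)
  also have "\<dots> = (\<Sum>i<degree p. of_int (coeff p i) * x ^ i) + x ^ degree p"
    using p(2) by (simp flip: lessThan_Suc_atMost)
  finally have *: "x ^ degree p = (\<Sum>i<degree p. of_int (- coeff p i) * x ^ i)"
    using p(1) by (simp add: sum_negf eq_neg_iff_add_eq_0 add.commute)
  \<comment> \<open>In degree 0 the relation would read 1 = 0, as its right side is an empty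
    sum.\<close>
  have "degree p > 0"
    using * by (cases "degree p") auto
  then show ?thesis using * that[of "degree p" "\<lambda>i. - coeff p i"] by auto
qed

text \<open>The group generated by the monomials \<open>x ^ i * y ^ j\<close> with
  \<open>i < m\<close> and \<open>j < n\<close> is stable under multiplication by \<open>x\<close>
  and by \<open>y\<close>, hence also by their sum and product.\<close>

lemma
  fixes x y :: "'a::field_char_0"
  assumes "algebraic_int x" "algebraic_int y"
  shows algebraic_int_add: "algebraic_int (x + y)"
    and algebraic_int_mult: "algebraic_int (x * y)"
proof -
  obtain m a where m: "m > 0" "x ^ m = (\<Sum>k<m. of_int (a k) * x ^ k)"
    using algebraic_int_power_eq[OF assms(1)] by blast
  obtain n b where n: "n > 0" "y ^ n = (\<Sum>k<n. of_int (b k) * y ^ k)"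
    using algebraic_int_power_eq[OF assms(2)] by blast
  define I where "I = {..<m} \<times> {..<n}"
  define v where "v = (\<lambda>(i, j). x ^ i * y ^ j)"
  have fin: "finite I" by (simp add: I_def)
  have base: "(i, j) \<in> I \<Longrightarrow> x ^ i * y ^ j \<in> int_span I v" for i j
    using int_span_base[OF fin, of "(i, j)" v] by (simp add: v_def)
  have x: "x * v i \<in> int_span I v" if iI: "i \<in> I" for i
  proof -
    obtain k l where i: "i = (k, l)" "k < m" "l < n" using iI unfolding I_def by blast
    show ?thesis
    proof (cases "Suc k < m")
      case True
      then have "x ^ Suc k * y ^ l \<in> int_span I v" using i by (intro base) (auto simp: I_def)
      then show ?thesis by (simp add: i v_def mult.assoc)
    next
      case False
      then have "Suc k = m" using i by simp
      \<comment> \<open>When the exponent leaves the range, the monic equation of \<open>x\<close>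
        replaces the top power by lower ones.\<close>
      then have "x * v i = x ^ m * y ^ l" by (auto simp: i v_def mult.assoc)
      also have "\<dots> = (\<Sum>k<m. of_int (a k) * (x ^ k * y ^ l))"
        by (simp add: m(2) sum_distrib_right mult.assoc)
      also have "\<dots> \<in> int_span I v"
        using i by (intro int_span_sum int_span_scale base) (auto simp: I_def)
      finally show ?thesis .
    qed
  qed
  have y: "y * v i \<in> int_span I v" if iI: "i \<in> I" for i
  proof -
    obtain k l where i: "i = (k, l)" "k < m" "l < n" using iI unfolding I_def by blast
    show ?thesis
    proof (cases "Suc l < n")
      case True
      then have "x ^ k * y ^ Suc l \<in> int_span I v" using i by (intro base) (auto simp: I_def)
      then show ?thesis by (simp add: i v_def algebra_simps)
    next
      case False
      then have "Suc l = n" using i by simp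
      then have "y * v i = x ^ k * y ^ n" by (auto simp: i v_def algebra_simps)
      also have "\<dots> = (\<Sum>l<n. of_int (b l) * (x ^ k * y ^ l))"
        by (simp add: n(2) sum_distrib_left algebra_simps)
      also have "\<dots> \<in> int_span I v"
        using i by (intro int_span_sum int_span_scale base) (auto simp: I_def)
      finally show ?thesis .
    qed
  qed
  have nz: "(0, 0) \<in> I" "v (0, 0) \<noteq> 0" using m n by (auto simp: I_def v_def)
  show "algebraic_int (x + y)"
    by (rule algebraic_int_if_stable[where v = v, OF fin nz]) (simp add: distrib_right x y int_span_add)
  show "algebraic_int (x * y)"
    by (rule algebraic_int_if_stable[where v = v, OF fin nz]) (simp add: mult.assoc x y int_span_mult)
qed

lemma algebraic_int_prod:
  fixes f :: "'b \<Rightarrow> 'a::field_char_0"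
  assumes "\<And>i. i \<in> I \<Longrightarrow> algebraic_int (f i)"
  shows "algebraic_int (prod f I)"
  using assms by (induction I rule: infinite_finite_induct) (auto intro: algebraic_int_mult)

lemma algebraic_int_sum:
  fixes f :: "'b \<Rightarrow> 'a::field_char_0"
  assumes "\<And>i. i \<in> I \<Longrightarrow> algebraic_int (f i)"
  shows "algebraic_int (sum f I)"
  using assms by (induction I rule: infinite_finite_induct) (auto intro: algebraic_int_add)

no_notation Matrix.vec_index (infixl "$" 100)
no_notation fps_nth (infixl "$" 75)
hide_const (open) Determinant.det Matrix.mat
hide_fact (open) Matrix.vec_eq_iff

section \<open>Embeddings of number fields\<close>

context
  fixes f :: "'k::field_char_0 \<Rightarrow> complex"
  assumes f: "field_embedding f"
begin

lemma field_embedding_add: "f (x + y) = f x + f y"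
  and field_embedding_mult: "f (x * y) = f x * f y"
  and field_embedding_1: "f 1 = 1"
  using f by (auto simp: field_embedding_def)

lemma field_embedding_0: "f 0 = 0"
  using field_embedding_add[of 0 0] by simp

lemma field_embedding_minus: "f (- x) = - f x"
  using field_embedding_add[of x "- x"] by (simp add: field_embedding_0 eq_neg_iff_add_eq_0 add.commute)

lemma field_embedding_sum: "f (sum g I) = (\<Sum>i\<in>I. f (g i))"
  by (induction I rule: infinite_finite_induct) (auto simp: field_embedding_0 field_embedding_add)

lemma field_embedding_power: "f (x ^ n) = f x ^ n"
  by (induction n) (auto simp: field_embedding_1 field_embedding_mult)

lemma field_embedding_of_nat: "f (of_nat n) = of_nat n"
  by (induction n) (auto simp: field_embedding_0 field_embedding_1 field_embedding_add)

lemma field_embedding_of_int: "f (of_int n) = of_int n"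
  by (cases n rule: int_cases2) (auto simp: field_embedding_of_nat field_embedding_minus)

lemma field_embedding_eq_0_iff: "f x = 0 \<longleftrightarrow> x = 0"
proof
  assume "f x = 0"
  then have "f (x * inverse x) = 0" by (simp add: field_embedding_mult)
  then show "x = 0" using field_embedding_1 by (cases "x = 0") auto
qed (simp add: field_embedding_0)

lemma field_embedding_inverse: "f (inverse x) = inverse (f x)"
proof (cases "x = 0")
  case False
  then have "f x * f (inverse x) = 1" by (simp flip: field_embedding_mult add: field_embedding_1)
  then show ?thesis by (metis inverse_unique)
qed (simp add: field_embedding_0)

lemma field_embedding_of_rat: "f (of_rat q) = of_rat q"
proof (cases q)
  case (Fract a b)
  then have "(of_rat q :: 'k) = of_int a * inverse (of_int b)"
    and "(of_rat q :: complex) = of_int a * inverse (of_int b)"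
    by (simp_all add: of_rat_rat divide_inverse)
  then show ?thesis
    by (simp only: field_embedding_mult field_embedding_of_int field_embedding_inverse)
qed

lemma field_embedding_inj: "f x = f y \<longleftrightarrow> x = y"
  using field_embedding_eq_0_iff[of "x - y"] field_embedding_add[of x "- y"] field_embedding_minus[of y]
  by simp

text \<open>Evaluation of integer polynomials commutes with \<open>f\<close>, so a monic equation of
  \<open>x\<close> is also one of \<open>f x\<close>.\<close>

lemma field_embedding_algebraic_int:
  assumes "algebraic_int x"
  shows "algebraic_int (f x)"
proof -
  obtain p where p: "poly (map_poly of_int p) x = 0" "lead_coeff p = 1"
    using assms unfolding algebraic_int_altdef_ipoly by blast
  have eq: "poly (map_poly of_int p) (f y) = f (poly (map_poly of_int p) y)" for y
    by (induction p) (auto simp: map_poly_pCons field_embedding_add field_embedding_mult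
          field_embedding_of_int field_embedding_0)
  then have "poly (map_poly of_int p) (f x) = 0" by (simp add: p(1) field_embedding_0)
  then show ?thesis using p(2) unfolding algebraic_int_altdef_ipoly by blast
qed

end

text \<open>Dedekind's independence of characters, by induction on the number of embeddings: comparing
  the relation at \<open>x * y\<close> with \<open>\<sigma> m y\<close> times the relation at \<open>x\<close> eliminates the embedding \<open>m\<close>.\<close>

lemma field_embeddings_independent:
  fixes \<sigma> :: "'n \<Rightarrow> 'k::field_char_0 \<Rightarrow> complex"
  assumes "finite N" "inj_on \<sigma> N" "\<And>n. n \<in> N \<Longrightarrow> field_embedding (\<sigma> n)"
    and "\<And>x. (\<Sum>n\<in>N. c n * \<sigma> n x) = 0" and "n \<in> N"
  shows "c n = 0"
  using assms
proof (induction N arbitrary: c n rule: finite_induct)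
  case empty
  then show ?case by simp
next
  case (insert m N)
  have rel: "c m * \<sigma> m x + (\<Sum>n\<in>N. c n * \<sigma> n x) = 0" for x
    using insert.prems(3)[of x] insert.hyps by simp
  have zero: "c k = 0" if k: "k \<in> N" for k
  proof -
    have "\<sigma> k \<noteq> \<sigma> m"
      using insert.prems(1) insert.hyps k by (auto simp: inj_on_def)
    then obtain y where y: "\<sigma> k y \<noteq> \<sigma> m y" by blast
    have "(\<Sum>n\<in>N. c n * (\<sigma> n y - \<sigma> m y) * \<sigma> n x) = 0" for x
    proof -
      have "(\<Sum>n\<in>N. c n * (\<sigma> n y - \<sigma> m y) * \<sigma> n x)
          = (\<Sum>n\<in>N. c n * \<sigma> n (x * y)) - \<sigma> m y * (\<Sum>n\<in>N. c n * \<sigma> n x)"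
        using insert.prems(2)
        by (simp add: field_embedding_mult sum_distrib_left sum_subtractf algebra_simps)
      also have "\<dots> = - c m * \<sigma> m (x * y) + \<sigma> m y * (c m * \<sigma> m x)"
        using rel[of "x * y"] rel[of x] by (simp add: add_eq_0_iff algebra_simps)
      also have "\<dots> = 0"
        using insert.prems(2) by (simp add: field_embedding_mult)
      finally show ?thesis .
    qed
    then have "c k * (\<sigma> k y - \<sigma> m y) = 0"
      using insert.IH[of "\<lambda>n. c n * (\<sigma> n y - \<sigma> m y)" k] insert.prems(1,2) k by auto
    then show ?thesis using y by simp
  qed
  then have "c m * \<sigma> m 1 = 0" using rel[of 1] by simp
  then have "c m = 0" using insert.prems(2)[of m] by (simp add: field_embedding_1)
  then show ?case using zero insert.prems(4) by auto
qed

text \<open>By the Leibniz formula the determinant is an integer polynomial in the entries.\<close>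

lemma det_in_Rats:
  fixes A :: "complex ^ 'n ^ 'n"
  assumes "\<And>i j. A $ i $ j \<in> \<rat>"
  shows "Determinants.det A \<in> \<rat>"
  unfolding Determinants.det_def
  by (intro Rats_sum Rats_mult Rats_prod Rats_of_int) (use assms in auto)

section \<open>Rational and integral bases, the norm, and the real span of the integers\<close>

locale number_field =
  fixes \<sigma> :: "'s::finite + ('t::finite + 't) \<Rightarrow> 'k::field_char_0 \<Rightarrow> complex"
  assumes embeddings: "number_field_embeddings \<sigma>"
begin

lemma embedding: "field_embedding (\<sigma> n)"
  using embeddings by (simp add: number_field_embeddings_def)

lemmas embedding_simps =
  field_embedding_add[OF embedding] field_embedding_mult[OF embedding]
  field_embedding_1[OF embedding] field_embedding_0[OF embedding]
  field_embedding_minus[OF embedding] field_embedding_power[OF embedding]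
  field_embedding_inverse[OF embedding] field_embedding_of_int[OF embedding]
  field_embedding_of_rat[OF embedding] field_embedding_sum[OF embedding]
  field_embedding_eq_0_iff[OF embedding]

lemma embedding_real: "\<sigma> (Inl i) x \<in> \<real>"
  using embeddings unfolding number_field_embeddings_def by blast

lemma embedding_cnj: "\<sigma> (Inr (Inr j)) x = cnj (\<sigma> (Inr (Inl j)) x)"
  using embeddings by (auto simp: number_field_embeddings_def)

text \<open>The degree is the number of embeddings, so a rational basis can be indexed by the same
  type as the embeddings. This makes the matrix of the values \<open>\<sigma> k (b i)\<close>
  square.\<close>

lemma rat_spanning:
  obtains b :: "'s + ('t + 't) \<Rightarrow> 'k"
  where "\<And>x. \<exists>q::'s + ('t + 't) \<Rightarrow> rat. x = (\<Sum>n\<in>UNIV. of_rat (q n) * b n)"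
proof -
  interpret V: vector_space "\<lambda>(q::rat) (x::'k). of_rat q * x"
    by unfold_locales (auto simp: algebra_simps of_rat_add of_rat_mult)
  have dim: "V.dim UNIV = CARD('s + ('t + 't))"
    using embeddings unfolding number_field_embeddings_def degree_over_rat_def by simp
  obtain B where B: "V.independent B" "UNIV \<subseteq> V.span B" "card B = V.dim UNIV"
    by (rule V.basis_exists[of UNIV]) simp
  \<comment> \<open>An infinite set has \<open>card\<close> 0, whereas this cardinality is
    positive.\<close>
  have "finite B" using B(3) dim by (metis card_gt_0_iff finite zero_less_card_finite)
  then obtain b :: "'s + ('t + 't) \<Rightarrow> 'k" where b: "bij_betw b UNIV B"
    using B(3) dim by (metis finite finite_same_card_bij)
  have "\<exists>q::'s + ('t + 't) \<Rightarrow> rat. x = (\<Sum>n\<in>UNIV. of_rat (q n) * b n)" for x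
  proof -
    have "x \<in> range (\<lambda>u. \<Sum>v\<in>B. of_rat (u v) * v)"
      using B(2) V.span_finite[OF \<open>finite B\<close>] by auto
    then obtain u where "(\<Sum>v\<in>B. of_rat (u v) * v) = x" by auto
    then have "x = (\<Sum>n\<in>UNIV. of_rat (u (b n)) * b n)"
      using sum.reindex_bij_betw[OF b, of "\<lambda>v. of_rat (u v) * v"] by simp
    then show ?thesis by (intro exI[of _ "\<lambda>n. u (b n)"])
  qed
  then show ?thesis using that by blast
qed

text \<open>Multiplication by \<open>x\<close> has a rational matrix with respect to the spanning
  family. Once its denominators are cleared, the family generates a group stable under
  multiplication by the multiple of \<open>x\<close>.\<close>

lemma algebraic_int_multiple:
  fixes x :: 'k
  obtains d :: int where "d > 0" "algebraic_int (of_int d * x)"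
proof -
  obtain b :: "'s + ('t + 't) \<Rightarrow> 'k"
    where b: "\<And>x. \<exists>q::'s + ('t + 't) \<Rightarrow> rat. x = (\<Sum>n\<in>UNIV. of_rat (q n) * b n)"
    using rat_spanning by blast
  obtain q where q: "\<And>i. x * b i = (\<Sum>j\<in>UNIV. of_rat (q i j) * b j)"
    using choice[of "\<lambda>i q. x * b i = (\<Sum>j\<in>UNIV. of_rat (q j) * b j)"] b by blast
  \<comment> \<open>The product of the denominators of all matrix entries.\<close>
  define d where "d = (\<Prod>i\<in>UNIV. \<Prod>j\<in>UNIV. snd (quotient_of (q i j)))"
  have "d > 0" unfolding d_def by (intro prod_pos ballI) (simp add: quotient_of_denom_pos')
  have "\<exists>z::int. of_int d * q i j = of_int z" for i j
  proof -
    have "snd (quotient_of (q i j)) dvd (\<Prod>j\<in>UNIV. snd (quotient_of (q i j)))"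
      by (rule dvd_prodI) auto
    also have "\<dots> dvd d" unfolding d_def by (rule dvd_prodI) auto
    finally obtain e where e: "d = snd (quotient_of (q i j)) * e" by blast
    have "q i j = of_int (fst (quotient_of (q i j))) / of_int (snd (quotient_of (q i j)))"
      by (rule quotient_of_div) simp
    then have "of_int d * q i j = of_int (e * fst (quotient_of (q i j)))"
      using quotient_of_denom_pos'[of "q i j"] by (simp add: e field_simps)
    then show ?thesis by blast
  qed
  then obtain z :: "_ \<Rightarrow> _ \<Rightarrow> int" where z: "\<And>i j. of_int d * q i j = of_int (z i j)" by metis
  have zk: "of_int d * of_rat (q i j) = (of_int (z i j) :: 'k)" for i j
    using arg_cong[OF z[of i j], of "of_rat :: rat \<Rightarrow> 'k"] by (simp add: of_rat_mult)
  obtain i0 where "b i0 \<noteq> 0"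
    using b[of 1] by (metis (no_types, lifting) mult_zero_right sum.neutral zero_neq_one)
  moreover have "of_int d * x * b i \<in> int_span UNIV b" for i
  proof -
    have "of_int d * x * b i = (\<Sum>j\<in>UNIV. of_int (z i j) * b j)"
      by (simp add: mult.assoc q sum_distrib_left flip: zk)
    then show ?thesis unfolding int_span_def by blast
  qed
  ultimately have "algebraic_int (of_int d * x)"
    by (intro algebraic_int_if_stable[where I = UNIV and v = b]) auto
  then show ?thesis using that \<open>d > 0\<close> by blast
qed

lemma integral_spanning:
  obtains b :: "'s + ('t + 't) \<Rightarrow> 'k"
  where "\<And>n. algebraic_int (b n)"
    and "\<And>x. \<exists>q::'s + ('t + 't) \<Rightarrow> rat. x = (\<Sum>n\<in>UNIV. of_rat (q n) * b n)"
proof -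
  obtain b :: "'s + ('t + 't) \<Rightarrow> 'k"
    where b: "\<And>x. \<exists>q::'s + ('t + 't) \<Rightarrow> rat. x = (\<Sum>n\<in>UNIV. of_rat (q n) * b n)"
    using rat_spanning by blast
  have "\<exists>d::int. d > 0 \<and> algebraic_int (of_int d * b n)" for n
    using algebraic_int_multiple by blast
  then obtain d :: "_ \<Rightarrow> int" where d: "\<And>n. d n > 0" "\<And>n. algebraic_int (of_int (d n) * b n)"
    by metis
  have "\<exists>q::'s + ('t + 't) \<Rightarrow> rat. x = (\<Sum>n\<in>UNIV. of_rat (q n) * (of_int (d n) * b n))" for x
  proof -
    obtain q where q: "x = (\<Sum>n\<in>UNIV. of_rat (q n) * b n)" using b by blast
    have "of_rat (q n) * b n = of_rat (q n / of_int (d n)) * (of_int (d n) * b n)" for n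
      using d(1)[of n] by (simp add: of_rat_divide)
    then show ?thesis unfolding q by (intro exI[of _ "\<lambda>n. q n / of_int (d n)"] sum.cong) auto
  qed
  then show ?thesis using that[of "\<lambda>n. of_int (d n) * b n"] d(2) by blast
qed

text \<open>A kernel vector is a linear relation between the embeddings on the family
  \<open>b\<close>. It extends to the whole field, as embeddings are linear over the rationals, and
  is then trivial by the independence of characters.\<close>

lemma embedding_matrix_invertible:
  fixes b :: "'s + ('t + 't) \<Rightarrow> 'k"
  assumes b: "\<And>x. \<exists>q::'s + ('t + 't) \<Rightarrow> rat. x = (\<Sum>n\<in>UNIV. of_rat (q n) * b n)"
  shows "invertible (\<chi> i k. \<sigma> k (b i))"
proof -
  have "c = 0" if c: "(\<chi> i k. \<sigma> k (b i)) *v c = 0" for c :: "complex ^ ('s + ('t + 't))"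
  proof -
    have c': "(\<Sum>k\<in>UNIV. c $ k * \<sigma> k (b i)) = 0" for i
      using c by (simp add: vec_eq_iff matrix_vector_mult_def mult.commute)
    have "(\<Sum>k\<in>UNIV. c $ k * \<sigma> k x) = 0" for x
    proof -
      obtain q where q: "x = (\<Sum>n\<in>UNIV. of_rat (q n) * b n)" using b by blast
      have "(\<Sum>k\<in>UNIV. c $ k * \<sigma> k x) = (\<Sum>k\<in>UNIV. \<Sum>n\<in>UNIV. of_rat (q n) * (c $ k * \<sigma> k (b n)))"
        by (simp add: q embedding_simps sum_distrib_left algebra_simps)
      also have "\<dots> = (\<Sum>n\<in>UNIV. of_rat (q n) * (\<Sum>k\<in>UNIV. c $ k * \<sigma> k (b n)))"
        by (subst sum.swap) (simp add: sum_distrib_left)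
      finally show ?thesis by (simp add: c')
    qed
    moreover have "inj \<sigma>" using embeddings by (simp add: number_field_embeddings_def)
    ultimately have "c $ k = 0" for k
      using field_embeddings_independent[of UNIV \<sigma> "\<lambda>k. c $ k" k] embedding by auto
    then show ?thesis by (simp add: vec_eq_iff)
  qed
  then show ?thesis
    by (simp add: invertible_left_inverse matrix_left_invertible_ker)
qed

text \<open>Let \<open>A\<close> be the rational matrix of multiplication by \<open>x\<close>,
  \<open>M\<close> the embedding matrix and \<open>D\<close> the diagonal matrix of the conjugates
  of \<open>x\<close>. Then \<open>A ** M = M ** D\<close>, so the product of the conjugates is the
  determinant of \<open>A\<close>.\<close>

lemma norm_rational: "(\<Prod>k\<in>UNIV. \<sigma> k x) \<in> \<rat>"
proof -
  obtain b :: "'s + ('t + 't) \<Rightarrow> 'k"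
    where b: "\<And>x. \<exists>q::'s + ('t + 't) \<Rightarrow> rat. x = (\<Sum>n\<in>UNIV. of_rat (q n) * b n)"
    using rat_spanning by blast
  obtain q where q: "\<And>i. x * b i = (\<Sum>j\<in>UNIV. of_rat (q i j) * b j)"
    using choice[of "\<lambda>i q. x * b i = (\<Sum>j\<in>UNIV. of_rat (q j) * b j)"] b by blast
  define M :: "complex ^ ('s + ('t + 't)) ^ ('s + ('t + 't))" where "M = (\<chi> i k. \<sigma> k (b i))"
  define A :: "complex ^ ('s + ('t + 't)) ^ ('s + ('t + 't))" where "A = (\<chi> i j. of_rat (q i j))"
  define D :: "complex ^ ('s + ('t + 't)) ^ ('s + ('t + 't))"
    where "D = (\<chi> k l. if k = l then \<sigma> k x else 0)"
  have "(A ** M) $ i $ k = (M ** D) $ i $ k" for i k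
  proof -
    have "(A ** M) $ i $ k = \<sigma> k (x * b i)"
      unfolding q by (simp add: A_def M_def matrix_matrix_mult_def embedding_simps)
    also have "\<dots> = (M ** D) $ i $ k"
      by (simp add: M_def D_def matrix_matrix_mult_def embedding_simps if_distrib cong: if_cong)
    finally show ?thesis .
  qed
  then have "A ** M = M ** D" by (simp add: vec_eq_iff)
  then have "Determinants.det A * Determinants.det M = Determinants.det M * Determinants.det D"
    by (metis det_mul)
  moreover have "Determinants.det M \<noteq> 0"
    using embedding_matrix_invertible[OF b] unfolding M_def by (simp add: invertible_det_nz)
  ultimately have "Determinants.det A = Determinants.det D" by simp
  also have "\<dots> = (\<Prod>k\<in>UNIV. \<sigma> k x)"
    by (subst det_diagonal) (auto simp: D_def)
  finally show ?thesis
    using det_in_Rats[of A] by (simp add: A_def)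
qed

text \<open>The norm is rational and an algebraic integer, hence an integer, and it is nonzero
  because embeddings are injective.\<close>

lemma norm_ge_1:
  assumes "algebraic_int x" "x \<noteq> 0"
  shows "(\<Prod>k\<in>UNIV. cmod (\<sigma> k x)) \<ge> 1"
proof -
  have "algebraic_int (\<Prod>k\<in>UNIV. \<sigma> k x)"
    by (intro algebraic_int_prod field_embedding_algebraic_int[OF embedding] assms)
  then have "(\<Prod>k\<in>UNIV. \<sigma> k x) \<in> \<int>"
    using rational_algebraic_int_is_int norm_rational by blast
  then obtain z where z: "(\<Prod>k\<in>UNIV. \<sigma> k x) = of_int z" by (rule Ints_cases)
  have "(\<Prod>k\<in>UNIV. \<sigma> k x) \<noteq> 0"
    using assms(2) by (simp add: embedding_simps)
  then have "\<bar>z\<bar> \<ge> 1" unfolding z by simp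
  then have "cmod (\<Prod>k\<in>UNIV. \<sigma> k x) \<ge> 1"
    unfolding z by (metis norm_of_int of_int_1_le_iff of_int_abs)
  then show ?thesis by (simp add: prod_norm)
qed

text \<open>The absolute norms of a unit and of its inverse are both at least 1, and their product
  is 1.\<close>

lemma norm_unit:
  assumes "x \<in> integer_units"
  shows "(\<Prod>k\<in>UNIV. cmod (\<sigma> k x)) = 1"
proof -
  obtain y where y: "algebraic_int x" "algebraic_int y" "x * y = 1"
    using assms by (auto simp: integer_units_def ring_of_integers_def)
  have "x \<noteq> 0" "y \<noteq> 0" using y(3) by auto
  have "(\<Prod>k\<in>UNIV. cmod (\<sigma> k x)) * (\<Prod>k\<in>UNIV. cmod (\<sigma> k y)) = (\<Prod>k\<in>UNIV. cmod (\<sigma> k (x * y)))"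
    by (simp add: prod.distrib embedding_simps norm_mult)
  also have "\<dots> = 1" by (simp add: y(3) embedding_simps)
  finally have *: "(\<Prod>k\<in>UNIV. cmod (\<sigma> k x)) * (\<Prod>k\<in>UNIV. cmod (\<sigma> k y)) = 1" .
  have 1: "(\<Prod>k\<in>UNIV. cmod (\<sigma> k x)) \<ge> 1" "(\<Prod>k\<in>UNIV. cmod (\<sigma> k y)) \<ge> 1"
    using norm_ge_1 y \<open>x \<noteq> 0\<close> \<open>y \<noteq> 0\<close> by auto
  then have "(\<Prod>k\<in>UNIV. cmod (\<sigma> k x)) * 1 \<le> (\<Prod>k\<in>UNIV. cmod (\<sigma> k x)) * (\<Prod>k\<in>UNIV. cmod (\<sigma> k y))"
    by (intro mult_left_mono) auto
  then show ?thesis using * 1 by linarith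
qed

text \<open>Invertibility of the embedding matrix gives a unique complex solution. Complex
  conjugation permutes the equations of the system, so the solution is real.\<close>

lemma integers_span_real:
  fixes b :: "'s + ('t + 't) \<Rightarrow> 'k" and r :: "'s \<Rightarrow> real" and z :: "'t \<Rightarrow> complex"
  assumes b: "\<And>x. \<exists>q::'s + ('t + 't) \<Rightarrow> rat. x = (\<Sum>n\<in>UNIV. of_rat (q n) * b n)"
  obtains c :: "'s + ('t + 't) \<Rightarrow> real"
  where "\<And>i. (\<Sum>n\<in>UNIV. of_real (c n) * \<sigma> (Inl i) (b n)) = of_real (r i)"
    and "\<And>j. (\<Sum>n\<in>UNIV. of_real (c n) * \<sigma> (Inr (Inl j)) (b n)) = z j"
proof -
  define M :: "complex ^ ('s + ('t + 't)) ^ ('s + ('t + 't))" where "M = (\<chi> i k. \<sigma> k (b i))"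
  \<comment> \<open>The right side is completed by \<open>cnj (z j)\<close> at the conjugate
    embeddings, to have the same symmetry under conjugation as the embeddings.\<close>
  define T :: "complex ^ ('s + ('t + 't))" where "T = (\<chi> k. case k of Inl i \<Rightarrow> of_real (r i)
     | Inr (Inl j) \<Rightarrow> z j | Inr (Inr j) \<Rightarrow> cnj (z j))"
  have "invertible (transpose M)"
    using embedding_matrix_invertible[OF b] by (simp add: M_def invertible_det_nz)
  then obtain N where N: "transpose M ** N = mat 1" "N ** transpose M = mat 1"
    unfolding invertible_def by blast
  define c where "c = N *v T"
  have "transpose M *v c = T"
    by (simp add: c_def matrix_vector_mul_assoc N(1))
  then have c: "(\<Sum>n\<in>UNIV. c $ n * \<sigma> k (b n)) = T $ k" for k
    by (auto simp: vec_eq_iff matrix_vector_mult_def transpose_def M_def mult.commute)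
  \<comment> \<open>The conjugate of the solution solves the same system: conjugation fixes the
    equations of the real embeddings and swaps those of conjugate pairs.\<close>
  define c' where "c' = (\<chi> n. cnj (c $ n))"
  have c': "(\<Sum>n\<in>UNIV. c' $ n * \<sigma> k (b n)) = T $ k" for k
  proof (cases k)
    case (Inl i)
    have "cnj (\<sigma> (Inl i) x) = \<sigma> (Inl i) x" for x using embedding_real by (simp add: Reals_cnj_iff)
    then show ?thesis using arg_cong[OF c[of k], of cnj] by (simp add: Inl c'_def T_def)
  next
    case (Inr m)
    then show ?thesis
    proof (cases m)
      case Inl': (Inl j)
      show ?thesis using arg_cong[OF c[of "Inr (Inr j)"], of cnj]
        by (simp add: Inr Inl' c'_def T_def embedding_cnj)
    next
      case Inr': (Inr j)
      show ?thesis using arg_cong[OF c[of "Inr (Inl j)"], of cnj]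
        by (simp add: Inr Inr' c'_def T_def embedding_cnj)
    qed
  qed
  have "transpose M *v c' = T"
    using c' by (auto simp: vec_eq_iff matrix_vector_mult_def transpose_def M_def mult.commute)
  then have "c' = N *v T"
    using N(2) by (metis matrix_vector_mul_assoc matrix_vector_mul_lid)
  then have "cnj (c $ n) = c $ n" for n
    by (metis c'_def c_def vec_lambda_beta)
  then have re: "of_real (Re (c $ n)) = c $ n" for n
    by (metis Reals_cnj_iff of_real_Re)
  show ?thesis
  proof (rule that[of "\<lambda>n. Re (c $ n)"])
    show "(\<Sum>n\<in>UNIV. of_real (Re (c $ n)) * \<sigma> (Inl i) (b n)) = of_real (r i)" for i
      using c[of "Inl i"] by (simp only: re) (simp add: T_def)
    show "(\<Sum>n\<in>UNIV. of_real (Re (c $ n)) * \<sigma> (Inr (Inl j)) (b n)) = z j" for j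
      using c[of "Inr (Inl j)"] by (simp only: re) (simp add: T_def)
  qed
qed

end

section \<open>Forms on the cover\<close>

text \<open>The linear part of the affine map \<open>OT_action\<close>, and so its derivative at
  every point.\<close>

definition OT_linear ::
  "('s::finite + ('t::finite + 't) \<Rightarrow> 'k::field_char_0 \<Rightarrow> complex) \<Rightarrow> 'k \<Rightarrow> ('s, 't) cover \<Rightarrow> ('s, 't) cover" where
  "OT_linear \<sigma> a = (\<lambda>(w, z). ((\<chi> i. \<sigma> (Inl i) a * w $ i), (\<chi> j. \<sigma> (Inr (Inl j)) a * z $ j)))"

definition OT_translation ::
  "('s::finite + ('t::finite + 't) \<Rightarrow> 'k::field_char_0 \<Rightarrow> complex) \<Rightarrow> 'k \<Rightarrow> ('s, 't) cover" where
  "OT_translation \<sigma> b = ((\<chi> i. \<sigma> (Inl i) b), (\<chi> j. \<sigma> (Inr (Inl j)) b))"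

lemma OT_action_eq: "OT_action \<sigma> (a, b) x = OT_linear \<sigma> a x + OT_translation \<sigma> b"
  by (cases x) (simp add: OT_action_def OT_linear_def OT_translation_def Finite_Cartesian_Product.vec_eq_iff)

lemma bounded_linear_OT_linear: "bounded_linear (OT_linear \<sigma> a)"
proof -
  have "linear (OT_linear \<sigma> a)"
  proof (rule linearI)
    show "OT_linear \<sigma> a (x + y) = OT_linear \<sigma> a x + OT_linear \<sigma> a y" for x y
      by (cases x; cases y) (simp add: OT_linear_def Finite_Cartesian_Product.vec_eq_iff algebra_simps)
    show "OT_linear \<sigma> a (r *\<^sub>R x) = r *\<^sub>R OT_linear \<sigma> a x" for r x
      by (cases x) (simp add: OT_linear_def Finite_Cartesian_Product.vec_eq_iff)
  qed
  then show ?thesis by (simp add: linear_conv_bounded_linear)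
qed

lemma OT_action_has_derivative: "(OT_action \<sigma> (a, b) has_derivative OT_linear \<sigma> a) (at x)"
proof -
  have "((\<lambda>x. OT_linear \<sigma> a x + OT_translation \<sigma> b) has_derivative (\<lambda>h. OT_linear \<sigma> a h + 0)) (at x)"
    by (intro has_derivative_add has_derivative_const
        bounded_linear.has_derivative[OF bounded_linear_OT_linear] has_derivative_ident)
  moreover have "OT_action \<sigma> (a, b) = (\<lambda>x. OT_linear \<sigma> a x + OT_translation \<sigma> b)"
    by (rule ext) (rule OT_action_eq)
  ultimately show ?thesis by simp
qed

lemma open_OT_cover: "open (OT_cover :: ('s::finite, 't::finite) cover set)"
proof -
  have eq: "(OT_cover :: ('s, 't) cover set) = (\<Inter>i. {x. 0 < Im (fst x $ i)})"
    by (auto simp: OT_cover_def)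
  have "open {x :: ('s, 't) cover. 0 < Im (fst x $ i)}" for i
    by (intro open_Collect_less continuous_intros)
  then show ?thesis unfolding eq by (intro open_INT) auto
qed

lemma Ck_on_SucD:
  assumes "Ck_on (Suc 0) S f" "x \<in> S"
  shows "f differentiable (at x)"
    and "continuous_on S (\<lambda>x. frechet_derivative f (at x) v)"
  using assms by auto

section \<open>The group action and the charts of the quotient\<close>

locale OT_data = number_field \<sigma> for \<sigma> :: "'s::finite + ('t::finite + 't) \<Rightarrow> 'k::field_char_0 \<Rightarrow> complex" +
  fixes U :: "'k set"
  assumes admissible: "admissible_units \<sigma> U"
begin

abbreviation Proj :: "('s, 't) cover \<Rightarrow> ('s, 't) cover set" where
  "Proj \<equiv> OT_proj \<sigma> U"

text \<open>These are the sets on which the atlas of \<open>OT_manifold\<close> is built;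
  \<open>chart V\<close> is the corresponding chart.\<close>

definition coord_domain :: "('s, 't) cover set \<Rightarrow> bool" where
  "coord_domain V \<longleftrightarrow> open V \<and> V \<subseteq> OT_cover \<and> inj_on Proj V"

abbreviation chart :: "('s, 't) cover set \<Rightarrow> (('s, 't) cover set, ('s, 't) cover) chart" where
  "chart V \<equiv> (Proj ` V, inv_into V Proj)"

lemma
  assumes "a \<in> U"
  shows U_unit: "a \<in> integer_units" and U_pos: "Re (\<sigma> (Inl i) a) > 0" and U_inverse: "inverse a \<in> U"
    and U_integer: "algebraic_int a" and U_nonzero: "a \<noteq> 0"
proof -
  show 1: "a \<in> integer_units" "Re (\<sigma> (Inl i) a) > 0" "inverse a \<in> U"
    using admissible assms
    by (auto simp: admissible_units_def mult_subgroup_def positive_units_def)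
  then show "algebraic_int a" "a \<noteq> 0" by (auto simp: integer_units_def ring_of_integers_def)
qed

lemma U_one: "1 \<in> U" and U_mult: "a \<in> U \<Longrightarrow> b \<in> U \<Longrightarrow> a * b \<in> U"
  using admissible by (auto simp: admissible_units_def mult_subgroup_def)

lemma U_power: "a \<in> U \<Longrightarrow> a ^ n \<in> U"
  by (induction n) (auto intro: U_one U_mult)

lemma embedding_real_eq: "\<sigma> (Inl i) x = of_real (Re (\<sigma> (Inl i) x))"
  using embedding_real by (simp add: of_real_Re)

text \<open>Real embeddings take real values: the translation leaves the imaginary part alone and
  the unit scales it.\<close>

lemma Im_OT_action: "Im (fst (OT_action \<sigma> (a, b) x) $ i) = Re (\<sigma> (Inl i) a) * Im (fst x $ i)"
proof -
  have "Im (\<sigma> (Inl i) y) = 0" for y using embedding_real complex_is_Real_iff by blast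
  then show ?thesis by (simp add: OT_action_def split: prod.splits)
qed

lemma OT_action_cover:
  assumes "x \<in> OT_cover" "a \<in> U"
  shows "OT_action \<sigma> (a, b) x \<in> OT_cover"
proof -
  have "Im (fst (OT_action \<sigma> (a, b) x) $ i) > 0" for i
    using assms U_pos[OF assms(2), of i] by (auto simp: Im_OT_action OT_cover_def)
  then show ?thesis by (auto simp: OT_cover_def split: prod.splits)
qed

lemma OT_action_compose:
  "OT_action \<sigma> (a', b') (OT_action \<sigma> (a, b) x) = OT_action \<sigma> (a' * a, a' * b + b') x"
  by (cases x) (simp add: OT_action_def Finite_Cartesian_Product.vec_eq_iff embedding_simps algebra_simps)

lemma OT_action_id: "OT_action \<sigma> (1, 0) x = x"
  by (cases x) (simp add: OT_action_def Finite_Cartesian_Product.vec_eq_iff embedding_simps)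

lemma OT_linear_1: "OT_linear \<sigma> 1 x = x"
  by (cases x) (simp add: OT_linear_def Finite_Cartesian_Product.vec_eq_iff embedding_simps)

lemma Proj_eq: "x \<in> OT_cover \<Longrightarrow> Proj x = {OT_action \<sigma> (a, b) x | a b. a \<in> U \<and> algebraic_int b}"
  by (auto simp: OT_proj_def OT_orbit_rel_def ring_of_integers_def OT_action_cover)

lemma Proj_action_subset:
  assumes "x \<in> OT_cover" "a \<in> U" "algebraic_int b"
  shows "Proj (OT_action \<sigma> (a, b) x) \<subseteq> Proj x"
proof
  fix y assume "y \<in> Proj (OT_action \<sigma> (a, b) x)"
  then obtain a' b' where y: "a' \<in> U" "algebraic_int b'" "y = OT_action \<sigma> (a' * a, a' * b + b') x"
    using assms by (auto simp: Proj_eq OT_action_cover OT_action_compose)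
  then have "a' * a \<in> U" "algebraic_int (a' * b + b')"
    using assms U_integer[of a'] by (simp_all add: U_mult algebraic_int_add algebraic_int_mult)
  then show "y \<in> Proj x" using assms(1) y(3) by (auto simp: Proj_eq)
qed

lemma Proj_action:
  assumes "x \<in> OT_cover" "a \<in> U" "algebraic_int b"
  shows "Proj (OT_action \<sigma> (a, b) x) = Proj x"
proof
  let ?y = "OT_action \<sigma> (a, b) x"
  have "OT_action \<sigma> (inverse a, - inverse a * b) ?y = x"
    using U_nonzero[OF assms(2)] by (simp add: OT_action_compose OT_action_id)
  moreover have "inverse a \<in> U" "algebraic_int (- inverse a * b)"
    using assms U_inverse[OF assms(2)] U_integer[of "inverse a"] by (simp_all add: algebraic_int_mult)
  ultimately show "Proj x \<subseteq> Proj ?y"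
    using Proj_action_subset[of ?y "inverse a" "- inverse a * b"] assms OT_action_cover by auto
qed (rule Proj_action_subset[OF assms])

lemma Proj_eqD:
  assumes "Proj x = Proj y" "x \<in> OT_cover" "y \<in> OT_cover"
  obtains a b where "a \<in> U" "algebraic_int b" "y = OT_action \<sigma> (a, b) x"
proof -
  have "y \<in> Proj y"
    unfolding Proj_eq[OF assms(3)] using U_one OT_action_id[of y]
    by (intro CollectI exI[of _ 1] exI[of _ 0]) simp
  then have "y \<in> Proj x" using assms(1) by simp
  then show ?thesis using assms(2) that by (auto simp: Proj_eq)
qed

text \<open>At a real embedding the value of \<open>a\<close> is positive, so a vanishing logarithm
  makes it 1, and embeddings are injective.\<close>

lemma U_eq_1:
  assumes a: "a \<in> U" and z: "proj_real (log_map \<sigma> a) = 0"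
  shows "a = 1"
proof -
  \<comment> \<open>Any real embedding will do; there is one because types are nonempty.\<close>
  obtain i :: 's where True by simp
  have "ln (cmod (\<sigma> (Inl i) a)) = 0"
    using z by (simp add: proj_real_def log_map_def Finite_Cartesian_Product.vec_eq_iff)
  moreover have "cmod (\<sigma> (Inl i) a) = Re (\<sigma> (Inl i) a)"
    using U_pos[OF a, of i] embedding_real_eq[of i a] by (metis abs_of_pos norm_of_real)
  ultimately have "Re (\<sigma> (Inl i) a) = 1"
    using U_pos[OF a, of i] by simp
  then have "\<sigma> (Inl i) a = \<sigma> (Inl i) 1"
    using embedding_real_eq[of i a] by (simp add: embedding_simps)
  then show ?thesis using field_embedding_inj[OF embedding] by blast
qed

text \<open>Suppose that \<open>(a, b)\<close> carries a point of a small neighbourhood to another.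
  Discreteness of the logarithmic lattice forces \<open>a = 1\<close>; then \<open>b\<close> is an
  integer with all conjugates small, so \<open>b = 0\<close>.\<close>

lemma exists_coord_domain:
  assumes x: "x \<in> OT_cover"
  obtains V where "coord_domain V" "x \<in> V"
proof -
  have "discrete (proj_real ` log_map \<sigma> ` U)" "0 \<in> proj_real ` log_map \<sigma> ` U"
    using admissible by (auto simp: admissible_units_def is_lattice_def)
  then obtain T where T: "open T" "T \<inter> proj_real ` log_map \<sigma> ` U = {0}"
    unfolding discrete_def isolated_in_def by blast
  then obtain \<epsilon> where eps: "\<epsilon> > 0" "ball 0 \<epsilon> \<subseteq> T"
    using open_contains_ball by blast
  \<comment> \<open>The action of \<open>(a, b)\<close> shifts \<open>L\<close> by
    \<open>proj_real (log_map \<sigma> a)\<close>.\<close>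
  define L :: "('s, 't) cover \<Rightarrow> real ^ 's" where "L = (\<lambda>y. \<chi> i. ln (Im (fst y $ i)))"
  have "continuous_on OT_cover L"
    unfolding L_def by (intro continuous_intros) (auto simp: OT_cover_def, metis less_irrefl)
  then have opL: "open (OT_cover \<inter> L -` ball (L x) (\<epsilon> / 2))"
    using continuous_open_preimage open_OT_cover by blast
  \<comment> \<open>Two points of this set have distance less than 1, and values of \<open>L\<close>
    less than \<open>\<epsilon>\<close> apart.\<close>
  define V where "V = (OT_cover \<inter> L -` ball (L x) (\<epsilon> / 2)) \<inter> ball x (1 / 2)"
  have "open V" unfolding V_def using opL by blast
  have "x \<in> V" using x eps by (simp add: V_def)
  have "inj_on Proj V"
  proof (rule inj_onI)
    fix y y' assume y: "y \<in> V" "y' \<in> V" "Proj y = Proj y'"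
    then have cov: "y \<in> OT_cover" "y' \<in> OT_cover" by (auto simp: V_def)
    obtain a b where ab: "a \<in> U" "algebraic_int b" "y' = OT_action \<sigma> (a, b) y"
      using Proj_eqD[OF y(3) cov] by blast
    have "proj_real (log_map \<sigma> a) = L y' - L y"
    proof -
      have "ln (cmod (\<sigma> (Inl i) a)) = ln (Im (fst y' $ i)) - ln (Im (fst y $ i))" for i
      proof -
        have "Im (fst y $ i) > 0" using cov by (auto simp: OT_cover_def)
        then have "ln (Im (fst y' $ i)) = ln (Re (\<sigma> (Inl i) a)) + ln (Im (fst y $ i))"
          using U_pos[OF ab(1), of i] by (simp add: ab(3) Im_OT_action ln_mult)
        moreover have "cmod (\<sigma> (Inl i) a) = Re (\<sigma> (Inl i) a)"
          using U_pos[OF ab(1), of i] embedding_real_eq[of i a] by (metis abs_of_pos norm_of_real)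
        ultimately show ?thesis by simp
      qed
      then show ?thesis
        by (simp add: proj_real_def log_map_def L_def Finite_Cartesian_Product.vec_eq_iff)
    qed
    moreover have "norm (L y' - L y) < \<epsilon>"
    proof -
      have "dist (L x) (L y) < \<epsilon> / 2" "dist (L x) (L y') < \<epsilon> / 2" using y by (auto simp: V_def)
      then have "dist (L y') (L y) < \<epsilon>" by (rule dist_triangle_half_r[rotated])
      then show ?thesis by (simp add: dist_norm)
    qed
    ultimately have "proj_real (log_map \<sigma> a) \<in> T" using eps by auto
    then have "proj_real (log_map \<sigma> a) = 0" using T(2) ab(1) by blast
    then have "a = 1" by (rule U_eq_1[OF ab(1)])
    then have diff: "y' - y = OT_translation \<sigma> b"
      by (simp add: ab(3) OT_action_eq OT_linear_1)
    have "dist x y < 1 / 2" "dist x y' < 1 / 2" using y by (auto simp: V_def)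
    then have "dist y' y < 1" by (rule dist_triangle_half_r[rotated])
    then have nrm: "norm (OT_translation \<sigma> b) < 1" by (simp add: dist_norm flip: diff)
    have lt: "cmod (\<sigma> k b) < 1" for k
    proof -
      have 1: "cmod (\<sigma> (Inl i) b) < 1" for i
      proof -
        have "cmod (\<sigma> (Inl i) b) = norm (fst (OT_translation \<sigma> b) $ i)" by (simp add: OT_translation_def)
        also have "\<dots> \<le> norm (fst (OT_translation \<sigma> b))" by (rule Finite_Cartesian_Product.norm_nth_le)
        also have "\<dots> \<le> norm (OT_translation \<sigma> b)" by (metis norm_fst_le prod.collapse)
        finally show ?thesis using nrm by simp
      qed
      have 2: "cmod (\<sigma> (Inr (Inl j)) b) < 1" for j
      proof -
        have "cmod (\<sigma> (Inr (Inl j)) b) = norm (snd (OT_translation \<sigma> b) $ j)" by (simp add: OT_translation_def)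
        also have "\<dots> \<le> norm (snd (OT_translation \<sigma> b))" by (rule Finite_Cartesian_Product.norm_nth_le)
        also have "\<dots> \<le> norm (OT_translation \<sigma> b)" by (metis norm_snd_le prod.collapse)
        finally show ?thesis using nrm by simp
      qed
      consider i where "k = Inl i" | j where "k = Inr (Inl j)" | j where "k = Inr (Inr j)"
        by (metis sum.exhaust)
      then show ?thesis using 1 2 by cases (auto simp: embedding_cnj)
    qed
    have "b = 0"
    proof (rule ccontr)
      assume "b \<noteq> 0"
      \<comment> \<open>All factors are below 1, against \<open>norm_ge_1\<close>. The index
        \<open>undefined\<close> is an arbitrary one at which the inequality is strict.\<close>
      have "(\<Prod>k\<in>UNIV. cmod (\<sigma> k b)) < (\<Prod>k\<in>(UNIV :: ('s + ('t + 't)) set). 1)"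
        using lt by (intro prod_mono_strict[of undefined]) (auto intro: less_imp_le)
      then show False using norm_ge_1[OF ab(2) \<open>b \<noteq> 0\<close>] by simp
    qed
    then show "y = y'" using ab(3) \<open>a = 1\<close> by (simp add: OT_action_id)
  qed
  then have "coord_domain V" using \<open>open V\<close> by (auto simp: coord_domain_def V_def)
  then show ?thesis using that \<open>x \<in> V\<close> by blast
qed

lemma coord_domainD:
  assumes "coord_domain V"
  shows "open V" "V \<subseteq> OT_cover" "inj_on Proj V"
  using assms by (auto simp: coord_domain_def)

lemma chart_coord: "coord_domain V \<Longrightarrow> x \<in> V \<Longrightarrow> inv_into V Proj (Proj x) = x"
  using coord_domainD(3) by (simp add: inv_into_f_f)

lemma chart_inverse: "coord_domain V \<Longrightarrow> x \<in> V \<Longrightarrow> inv_into (Proj ` V) (inv_into V Proj) x = Proj x"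
  by (rule inv_into_f_eq) (auto simp: inj_on_def chart_coord)

lemma chart_image: "coord_domain V \<Longrightarrow> inv_into V Proj ` Proj ` V = V"
  using coord_domainD(3) by (simp add: inj_on_image_eq_iff image_image chart_coord)

lemma chart_in_atlas: "coord_domain V \<Longrightarrow> chart V \<in> atlas (OT_manifold \<sigma> U)"
  unfolding OT_manifold_def coord_domain_def by auto

lemma chart_in_charts_at:
  "coord_domain V \<Longrightarrow> Proj x \<in> Proj ` V \<Longrightarrow> chart V \<in> charts_at (OT_manifold \<sigma> U) (Proj x)"
  by (simp add: charts_at_def chart_in_atlas)

lemma Proj_in_points: "x \<in> OT_cover \<Longrightarrow> Proj x \<in> points (OT_manifold \<sigma> U)"
  by (simp add: OT_manifold_def OT_proj_def quotientI)

text \<open>Near \<open>x\<close> the transition map coincides with the action of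
  \<open>(a, b)\<close>, namely on the open set of the points of \<open>V\<close> that the action
  moves into \<open>W\<close>.\<close>

lemma transition_derivative:
  assumes V: "coord_domain V" "x \<in> V" and W: "coord_domain W" "OT_action \<sigma> (a, b) x \<in> W"
    and ab: "a \<in> U" "algebraic_int b"
  shows "frechet_derivative (transition (chart V) (chart W)) (at x) = OT_linear \<sigma> a"
proof -
  let ?g = "OT_action \<sigma> (a, b)"
  have "continuous_on UNIV ?g"
    by (intro continuous_at_imp_continuous_on ballI has_derivative_continuous[OF OT_action_has_derivative])
  then have op: "open (?g -` W)" using coord_domainD(1)[OF W(1)] by (simp add: continuous_on_open_vimage)
  have "(transition (chart V) (chart W) has_derivative OT_linear \<sigma> a) (at x)"
  proof (rule has_derivative_transform_within_open[OF OT_action_has_derivative[of \<sigma> a b]])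
    show "open (V \<inter> ?g -` W)" using op coord_domainD(1)[OF V(1)] by blast
    show "x \<in> V \<inter> ?g -` W" using V W by simp
    show "?g y = transition (chart V) (chart W) y" if y: "y \<in> V \<inter> ?g -` W" for y
    proof -
      have "Proj (?g y) = Proj y" using y coord_domainD(2)[OF V(1)] ab by (intro Proj_action) auto
      then have "inv_into W Proj (Proj y) = ?g y"
        using chart_coord[OF W(1), of "?g y"] y by simp
      then show ?thesis using chart_inverse[OF V(1)] y by (simp add: transition_def)
    qed
  qed
  then show ?thesis by (rule frechet_derivative_at[symmetric])
qed

section \<open>Pulling forms back to the cover\<close>

lemma form_invariant:
  assumes form: "differential_2_form (OT_manifold \<sigma> U) \<Omega>"
    and V: "coord_domain V" "x \<in> V" and W: "coord_domain W" "OT_action \<sigma> (a, b) x \<in> W"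
    and ab: "a \<in> U" "algebraic_int b"
  shows "\<Omega> (chart V) x u v = \<Omega> (chart W) (OT_action \<sigma> (a, b) x) (OT_linear \<sigma> a u) (OT_linear \<sigma> a v)"
proof -
  let ?y = "OT_action \<sigma> (a, b) x"
  have x: "x \<in> OT_cover" using V coord_domainD(2) by blast
  have eq: "Proj ?y = Proj x" using x ab by (rule Proj_action)
  have "chart V \<in> charts_at (OT_manifold \<sigma> U) (Proj x)" "chart W \<in> charts_at (OT_manifold \<sigma> U) (Proj x)"
    using chart_in_charts_at[OF V(1)] chart_in_charts_at[OF W(1)] V(2) imageI[OF W(2), of Proj] eq by auto
  moreover have "snd (chart V) (Proj x) = x" using V by (simp add: chart_coord)
  moreover have "snd (chart W) (Proj x) = ?y" using chart_coord[OF W] eq by simp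
  ultimately show ?thesis
    using form Proj_in_points[OF x] transition_derivative[OF V W ab]
    unfolding differential_2_form_def by metis
qed

text \<open>The form is read in an arbitrarily chosen coordinate domain around \<open>x\<close>; for
  a differential form the choice has no effect, by \<open>pullback_eq\<close>.\<close>

definition pullback :: "(('s, 't) cover set, ('s, 't) cover) form2 \<Rightarrow> ('s, 't) cover \<Rightarrow> ('s, 't) cover \<Rightarrow> ('s, 't) cover \<Rightarrow> real" where
  "pullback \<Omega> x = \<Omega> (chart (SOME V. coord_domain V \<and> x \<in> V)) x"

text \<open>Two coordinate domains around the same point are compared by
  \<open>form_invariant\<close> with the identity \<open>(1, 0)\<close> as the group
  element.\<close>

lemma pullback_eq:
  assumes "differential_2_form (OT_manifold \<sigma> U) \<Omega>" "coord_domain V" "x \<in> V"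
  shows "pullback \<Omega> x u v = \<Omega> (chart V) x u v"
proof -
  define W where "W = (SOME V. coord_domain V \<and> x \<in> V)"
  have "coord_domain W \<and> x \<in> W" unfolding W_def by (rule someI[of _ V]) (use assms in auto)
  then show ?thesis
    using form_invariant[OF assms(1), of W x V 1 0 u v] assms U_one
    by (simp add: pullback_def OT_action_id OT_linear_1 flip: W_def)
qed

lemma pullback_invariant:
  assumes "differential_2_form (OT_manifold \<sigma> U) \<Omega>" "x \<in> OT_cover" "a \<in> U" "algebraic_int b"
  shows "pullback \<Omega> (OT_action \<sigma> (a, b) x) (OT_linear \<sigma> a u) (OT_linear \<sigma> a v) = pullback \<Omega> x u v"
proof -
  obtain V where V: "coord_domain V" "x \<in> V" using exists_coord_domain[OF assms(2)] by blast
  obtain W where W: "coord_domain W" "OT_action \<sigma> (a, b) x \<in> W"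
    using exists_coord_domain[OF OT_action_cover[OF assms(2,3)]] by blast
  show ?thesis
    using form_invariant[OF assms(1) V W assms(3,4)] pullback_eq[OF assms(1)] V W by simp
qed

lemma pullback_bilinear:
  assumes "differential_2_form (OT_manifold \<sigma> U) \<Omega>" "x \<in> OT_cover"
  shows "bilinear (pullback \<Omega> x)" "pullback \<Omega> x u u = 0"
proof -
  obtain V where V: "coord_domain V" "x \<in> V" using exists_coord_domain[OF assms(2)] by blast
  have "pullback \<Omega> x = \<Omega> (chart V) x"
    by (intro ext) (rule pullback_eq[OF assms(1) V])
  moreover have "chart V \<in> charts_at (OT_manifold \<sigma> U) (Proj x)" "snd (chart V) (Proj x) = x"
    using V by (auto intro!: chart_in_charts_at simp: chart_coord)
  ultimately show "bilinear (pullback \<Omega> x)" "pullback \<Omega> x u u = 0"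
    using assms Proj_in_points[OF assms(2)] unfolding differential_2_form_def by metis+
qed

lemma pullback_tamed:
  assumes "differential_2_form (OT_manifold \<sigma> U) \<Omega>" "tames (OT_manifold \<sigma> U) \<Omega>" "x \<in> OT_cover" "u \<noteq> 0"
  shows "pullback \<Omega> x u (model_J (OT_manifold \<sigma> U) u) > 0"
proof -
  obtain V where V: "coord_domain V" "x \<in> V" using exists_coord_domain[OF assms(3)] by blast
  have "pullback \<Omega> x = \<Omega> (chart V) x"
    by (intro ext) (rule pullback_eq[OF assms(1) V])
  moreover have "chart V \<in> charts_at (OT_manifold \<sigma> U) (Proj x)" "snd (chart V) (Proj x) = x"
    using V by (auto intro!: chart_in_charts_at simp: chart_coord)
  ultimately show ?thesis
    using assms(2,4) Proj_in_points[OF assms(3)] unfolding tames_def by metis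
qed

text \<open>The regularity used in the flux argument: the coefficients are differentiated once, and
  these derivatives are integrated.\<close>

lemma pullback_C1:
  assumes "differential_2_form (OT_manifold \<sigma> U) \<Omega>" "x \<in> OT_cover"
  shows "(\<lambda>y. pullback \<Omega> y u v) differentiable (at x)"
    and "isCont (\<lambda>x. frechet_derivative (\<lambda>y. pullback \<Omega> y u v) (at x) h) x"
proof -
  obtain V where V: "coord_domain V" "x \<in> V" using exists_coord_domain[OF assms(2)] by blast
  note oV = coord_domainD(1)[OF V(1)]
  have "smooth_on V (\<lambda>y. \<Omega> (chart V) y u v)"
    using assms(1) chart_in_atlas[OF V(1)] chart_image[OF V(1)]
    unfolding differential_2_form_def by (metis fst_conv snd_conv)
  then have C: "Ck_on (Suc 0) V (\<lambda>y. \<Omega> (chart V) y u v)"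
    unfolding smooth_on_def by blast
  have eq: "\<Omega> (chart V) y u v = pullback \<Omega> y u v" if "y \<in> V" for y
    using pullback_eq[OF assms(1) V(1) that] by simp
  have d: "((\<lambda>y. pullback \<Omega> y u v) has_derivative frechet_derivative (\<lambda>y. \<Omega> (chart V) y u v) (at y)) (at y)"
    if "y \<in> V" for y
    by (rule has_derivative_transform_within_open[OF _ oV that eq])
       (use Ck_on_SucD(1)[OF C that] in \<open>auto simp: frechet_derivative_works\<close>)
  show "(\<lambda>y. pullback \<Omega> y u v) differentiable (at x)"
    using d[OF V(2)] by (rule differentiableI)
  have "frechet_derivative (\<lambda>y. pullback \<Omega> y u v) (at y) = frechet_derivative (\<lambda>y. \<Omega> (chart V) y u v) (at y)"
    if "y \<in> V" for y
    using frechet_derivative_at[OF d[OF that]] by simp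
  then have "continuous_on V (\<lambda>x. frechet_derivative (\<lambda>y. pullback \<Omega> y u v) (at x) h)"
    using Ck_on_SucD(2)[OF C V(2), of h] by (simp cong: continuous_on_cong)
  then show "isCont (\<lambda>x. frechet_derivative (\<lambda>y. pullback \<Omega> y u v) (at x) h) x"
    using oV V(2) continuous_on_eq_continuous_at by blast
qed

lemma pullback_closed:
  assumes "symplectic_form (OT_manifold \<sigma> U) \<Omega>" "x \<in> OT_cover"
  shows "ext_deriv2 (pullback \<Omega>) x u v w = 0"
proof -
  have form: "differential_2_form (OT_manifold \<sigma> U) \<Omega>"
    using assms(1) by (simp add: symplectic_form_def)
  obtain V where V: "coord_domain V" "x \<in> V" using exists_coord_domain[OF assms(2)] by blast
  have "frechet_derivative (\<lambda>y. pullback \<Omega> y p q) (at x) = frechet_derivative (\<lambda>y. \<Omega> (chart V) y p q) (at x)"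
    for p q
    by (rule frechet_derivative_transform_within_open[OF pullback_C1(1)[OF form assms(2)] coord_domainD(1)[OF V(1)] V(2)])
       (rule pullback_eq[OF form V(1)])
  then have "ext_deriv2 (pullback \<Omega>) x u v w = ext_deriv2 (\<Omega> (chart V)) x u v w"
    by (simp add: ext_deriv2_def)
  also have "chart V \<in> charts_at (OT_manifold \<sigma> U) (Proj x)" "snd (chart V) (Proj x) = x"
    using V by (auto intro!: chart_in_charts_at simp: chart_coord)
  then have "ext_deriv2 (\<Omega> (chart V)) x u v w = 0"
    using assms(1) Proj_in_points[OF assms(2)] unfolding symplectic_form_def by metis
  finally show ?thesis .
qed

end

section \<open>Averages of a closed form over growing squares\<close>

text \<open>Integrating in the first variable leaves the difference of \<open>p\<close> on two
  opposite sides of the square, which is at most \<open>2 * C\<close> along a length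
  \<open>R\<close>.\<close>

lemma integral_square_deriv_fst:
  fixes p p' :: "real \<times> real \<Rightarrow> real"
  assumes R: "R > 0"
    and dp: "\<And>a b. ((\<lambda>a. p (a, b)) has_real_derivative p' (a, b)) (at a)"
    and cont: "continuous_on UNIV p" "continuous_on UNIV p'"
    and bound: "\<And>y. \<bar>p y\<bar> \<le> C"
  shows "\<bar>integral (cbox (0, 0) (R, R)) p'\<bar> \<le> 2 * C * R"
proof -
  have cont': "continuous_on (cbox (0, 0) (R, R)) (\<lambda>(a, b). p' (a, b))"
    using continuous_on_subset[OF cont(2)] by simp
  have contb: "continuous_on {0..R} (\<lambda>b. p (R, b) - p (0, b))"
    by (intro continuous_intros continuous_on_compose2[OF cont(1)]) auto
  have "integral (cbox (0, 0) (R, R)) p' = integral (cbox 0 R) (\<lambda>a. integral (cbox 0 R) (\<lambda>b. p' (a, b)))"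
    using integral_prod_continuous[of 0 0 R R p'] cont' by simp
  \<comment> \<open>The order is swapped so that the inner integral is in the variable of
    differentiation.\<close>
  also have "\<dots> = integral (cbox 0 R) (\<lambda>b. integral (cbox 0 R) (\<lambda>a. p' (a, b)))"
    by (rule integral_swap_continuous[OF cont'])
  also have "\<dots> = integral {0..R} (\<lambda>b. p (R, b) - p (0, b))"
  proof -
    have *: "((\<lambda>a. p' (a, b)) has_integral (p (R, b) - p (0, b))) {0..R}" for b
      by (rule fundamental_theorem_of_calculus)
        (use R dp in \<open>auto simp: has_real_derivative_iff_has_vector_derivative[symmetric]
           intro: has_field_derivative_at_within\<close>)
    show ?thesis by (simp add: integral_unique[OF *])
  qed
  also have "\<bar>\<dots>\<bar> \<le> 2 * C * (R - 0)"
  proof -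
    have "norm (p (R, b) - p (0, b)) \<le> 2 * C" for b
      using bound[of "(R, b)"] bound[of "(0, b)"] by simp
    then show ?thesis
      using integral_bound[OF _ contb, of "2 * C"] R by simp
  qed
  finally show ?thesis by simp
qed

lemma integral_square_deriv_snd:
  fixes p p' :: "real \<times> real \<Rightarrow> real"
  assumes R: "R > 0"
    and dp: "\<And>a b. ((\<lambda>b. p (a, b)) has_real_derivative p' (a, b)) (at b)"
    and cont: "continuous_on UNIV p" "continuous_on UNIV p'"
    and bound: "\<And>y. \<bar>p y\<bar> \<le> C"
  shows "\<bar>integral (cbox (0, 0) (R, R)) p'\<bar> \<le> 2 * C * R"
proof -
  have cont': "continuous_on (cbox (0, 0) (R, R)) (\<lambda>(a, b). p' (a, b))"
    using continuous_on_subset[OF cont(2)] by simp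
  have conta: "continuous_on {0..R} (\<lambda>a. p (a, R) - p (a, 0))"
    by (intro continuous_intros continuous_on_compose2[OF cont(1)]) auto
  have "integral (cbox (0, 0) (R, R)) p' = integral (cbox 0 R) (\<lambda>a. integral (cbox 0 R) (\<lambda>b. p' (a, b)))"
    using integral_prod_continuous[of 0 0 R R p'] cont' by simp
  also have "\<dots> = integral {0..R} (\<lambda>a. p (a, R) - p (a, 0))"
  proof -
    have *: "((\<lambda>b. p' (a, b)) has_integral (p (a, R) - p (a, 0))) {0..R}" for a
      by (rule fundamental_theorem_of_calculus)
        (use R dp in \<open>auto simp: has_real_derivative_iff_has_vector_derivative[symmetric]
           intro: has_field_derivative_at_within\<close>)
    show ?thesis by (simp add: integral_unique[OF *])
  qed
  also have "\<bar>\<dots>\<bar> \<le> 2 * C * (R - 0)"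
  proof -
    have "norm (p (a, R) - p (a, 0)) \<le> 2 * C" for a
      using bound[of "(a, R)"] bound[of "(a, 0)"] by simp
    then show ?thesis
      using integral_bound[OF _ conta, of "2 * C"] R by simp
  qed
  finally show ?thesis by simp
qed

text \<open>The integral of \<open>f\<close> over a square of side \<open>R\<close> changes along \<open>t\<close> by boundary terms only, that is,
  by \<open>O(R)\<close>, so that the average of \<open>f\<close> over large squares is constant.\<close>

lemma flux_estimate:
  fixes f p p' q q' :: "real \<Rightarrow> real \<times> real \<Rightarrow> real"
  assumes df: "\<And>t y. t \<in> {0..1} \<Longrightarrow> ((\<lambda>t. f t y) has_real_derivative p' t y - q' t y) (at t within {0..1})"
    and dp: "\<And>t a b. t \<in> {0..1} \<Longrightarrow> ((\<lambda>a. p t (a, b)) has_real_derivative p' t (a, b)) (at a)"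
    and dq: "\<And>t a b. t \<in> {0..1} \<Longrightarrow> ((\<lambda>b. q t (a, b)) has_real_derivative q' t (a, b)) (at b)"
    and cont: "\<And>t. t \<in> {0..1} \<Longrightarrow> continuous_on UNIV (f t)"
      "\<And>t. t \<in> {0..1} \<Longrightarrow> continuous_on UNIV (p t)"
      "\<And>t. t \<in> {0..1} \<Longrightarrow> continuous_on UNIV (q t)"
    and cont': "continuous_on ({0..1} \<times> UNIV) (\<lambda>(t, y). p' t y)"
      "continuous_on ({0..1} \<times> UNIV) (\<lambda>(t, y). q' t y)"
    and bound: "\<And>t y. t \<in> {0..1} \<Longrightarrow> \<bar>p t y\<bar> \<le> C" "\<And>t y. t \<in> {0..1} \<Longrightarrow> \<bar>q t y\<bar> \<le> C"
    and ends: "\<And>y. f 0 y \<le> M" "\<And>y. m \<le> f 1 y"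
  shows "m \<le> M"
proof (rule ccontr)
  assume "\<not> m \<le> M"
  \<comment> \<open>Chosen so that \<open>(m - M) * R = 4 * \<bar>C\<bar> + (m - M)\<close>, which
    exceeds the bound \<open>4 * C\<close> obtained from the boundary terms; the summand 1 also
    makes \<open>R\<close> positive.\<close>
  define R where "R = 4 * \<bar>C\<bar> / (m - M) + 1"
  have R: "R > 0" using \<open>\<not> m \<le> M\<close> by (simp add: R_def add_nonneg_pos)
  define S :: "(real \<times> real) set" where "S = cbox (0, 0) (R, R)"
  have contS: "continuous_on S (f t)" if "t \<in> {0..1}" for t
    using cont(1)[OF that] continuous_on_subset by blast
  have cp: "continuous_on UNIV (p' t)" "continuous_on UNIV (q' t)" if t: "t \<in> {0..1}" for t
  proof -
    have "continuous_on UNIV (Pair t :: real \<times> real \<Rightarrow> _)" "range (Pair t) \<subseteq> {0..1} \<times> UNIV"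
      using t by (auto intro!: continuous_intros)
    then show "continuous_on UNIV (p' t)" "continuous_on UNIV (q' t)"
      using continuous_on_compose2[OF cont'(1), of UNIV "Pair t"]
        continuous_on_compose2[OF cont'(2), of UNIV "Pair t"] by simp_all
  qed
  have deriv: "((\<lambda>t. integral S (f t)) has_real_derivative integral S (\<lambda>y. p' t y - q' t y)) (at t within {0..1})"
    if "t \<in> {0..1}" for t
    unfolding S_def
  proof (rule leibniz_rule_field_derivative)
    show "continuous_on ({0..1} \<times> cbox (0, 0) (R, R)) (\<lambda>(t, y). p' t y - q' t y)"
      using continuous_on_subset[OF continuous_on_diff[OF cont'], of "{0..1} \<times> cbox (0, 0) (R, R)"]
      by (auto simp: split_def)
    show "f t integrable_on cbox (0, 0) (R, R)" if "t \<in> {0..1}" for t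
      using contS[OF that] unfolding S_def by (rule integrable_continuous)
  qed (use that df in auto)
  \<comment> \<open>Each of the two partial derivatives contributes the flux through one pair of
    opposite sides, at most \<open>2 * C * R\<close>.\<close>
  have bd: "norm (integral S (\<lambda>y. p' t y - q' t y)) \<le> 4 * C * R" if t: "t \<in> {0..1}" for t
  proof -
    have "integral S (\<lambda>y. p' t y - q' t y) = integral S (p' t) - integral S (q' t)"
      using cp[OF t] unfolding S_def
      by (intro Henstock_Kurzweil_Integration.integral_diff integrable_continuous) (auto intro: continuous_on_subset)
    moreover have "\<bar>integral S (p' t)\<bar> \<le> 2 * C * R"
      unfolding S_def by (rule integral_square_deriv_fst[where p = "p t"]) (use t R dp cont cp bound in auto)
    moreover have "\<bar>integral S (q' t)\<bar> \<le> 2 * C * R"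
      unfolding S_def by (rule integral_square_deriv_snd[where p = "q t"]) (use t R dq cont cp bound in auto)
    ultimately show ?thesis by simp
  qed
  have "norm (integral S (f 1) - integral S (f 0)) \<le> 4 * C * R * norm (1 - 0 :: real)"
    by (rule field_differentiable_bound[OF _ deriv bd]) auto
  moreover have "m * (R * R) \<le> integral S (f 1)"
  proof -
    have "integral S (\<lambda>_. m) \<le> integral S (f 1)"
      unfolding S_def by (intro integral_le integrable_continuous) (use contS ends in \<open>auto simp: S_def\<close>)
    then show ?thesis using R by (simp add: S_def content_Pair mult.commute)
  qed
  moreover have "integral S (f 0) \<le> M * (R * R)"
  proof -
    have "integral S (f 0) \<le> integral S (\<lambda>_. M)"
      unfolding S_def by (intro integral_le integrable_continuous) (use contS ends in \<open>auto simp: S_def\<close>)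
    then show ?thesis using R by (simp add: S_def content_Pair mult.commute)
  qed
  ultimately have "(m - M) * R * R \<le> 4 * C * R" by (simp add: algebra_simps)
  then have "(m - M) * R \<le> 4 * C" using R by simp
  moreover have "(m - M) * R = 4 * \<bar>C\<bar> + (m - M)"
    using \<open>\<not> m \<le> M\<close> by (simp add: R_def field_simps)
  ultimately show False using \<open>\<not> m \<le> M\<close> by linarith
qed

context OT_data
begin

section \<open>Units and translations\<close>

lemma prod_embeddings:
  fixes g :: "'s + ('t + 't) \<Rightarrow> real"
  shows "(\<Prod>k\<in>UNIV. g k) = (\<Prod>i\<in>UNIV. g (Inl i)) * ((\<Prod>j\<in>UNIV. g (Inr (Inl j))) * (\<Prod>j\<in>UNIV. g (Inr (Inr j))))"
  by (simp add: UNIV_Plus_UNIV[symmetric] prod.Plus del: UNIV_Plus_UNIV)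

text \<open>Otherwise all complex embeddings have absolute value 1 on \<open>U\<close>. As units
  have norm 1, the logarithms at the real embeddings then sum to 0, so the lattice would lie in a
  hyperplane and could not span.\<close>

lemma exists_expanding_unit:
  "\<exists>u\<in>U. \<exists>j. cmod (\<sigma> (Inr (Inl j)) u) > 1"
proof (rule ccontr)
  assume "\<not> ?thesis"
  then have le: "cmod (\<sigma> (Inr (Inl j)) u) \<le> 1" if "u \<in> U" for u j
    using that by (meson not_le)
  \<comment> \<open>The assumed bound for the inverse unit is the opposite inequality.\<close>
  have one: "cmod (\<sigma> (Inr (Inl j)) u) = 1" if u: "u \<in> U" for u j
  proof -
    have "inverse (cmod (\<sigma> (Inr (Inl j)) u)) \<le> 1"
      using le[OF U_inverse[OF u], of j] by (simp add: embedding_simps norm_inverse)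
    moreover have "cmod (\<sigma> (Inr (Inl j)) u) > 0"
      using U_nonzero[OF u] by (simp add: embedding_simps)
    ultimately show ?thesis using le[OF u, of j] by (simp add: inverse_le_1_iff)
  qed
  have sum0: "(\<Sum>i\<in>UNIV. proj_real (log_map \<sigma> u) $ i) = 0" if u: "u \<in> U" for u
  proof -
    have "(\<Prod>i\<in>UNIV. cmod (\<sigma> (Inl i) u)) = 1"
      using norm_unit[OF U_unit[OF u]] by (simp add: prod_embeddings embedding_cnj one[OF u])
    moreover have "ln (\<Prod>i\<in>UNIV. cmod (\<sigma> (Inl i) u)) = (\<Sum>i\<in>UNIV. ln (cmod (\<sigma> (Inl i) u)))"
      by (rule ln_prod) (use U_nonzero[OF u] in \<open>auto simp: embedding_simps\<close>)
    ultimately show ?thesis by (simp add: proj_real_def log_map_def)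
  qed
  have "subspace {x :: real ^ 's. (\<Sum>i\<in>UNIV. x $ i) = 0}"
    by (auto simp: subspace_def sum.distrib simp flip: sum_distrib_left)
  then have "span (proj_real ` log_map \<sigma> ` U) \<subseteq> {x. (\<Sum>i\<in>UNIV. x $ i) = 0}"
    by (rule span_minimal[rotated]) (use sum0 in auto)
  moreover have "span (proj_real ` log_map \<sigma> ` U) = UNIV"
    using admissible by (simp add: admissible_units_def is_lattice_def)
  ultimately have "(\<chi> i. 1) \<in> {x :: real ^ 's. (\<Sum>i\<in>UNIV. x $ i) = 0}" by blast
  then show False by simp
qed

text \<open>The directions that keep the imaginary parts of the half plane coordinates fixed. They
  contain all translations by integers, and are the real span of these.\<close>

definition real_directions :: "('s, 't) cover set" where
  "real_directions = {v. \<forall>i. Im (fst v $ i) = 0}"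

lemma subspace_real_directions: "subspace real_directions"
  by (auto simp: subspace_def real_directions_def)

lemma OT_cover_add_real: "v \<in> real_directions \<Longrightarrow> x + v \<in> OT_cover \<longleftrightarrow> x \<in> OT_cover"
  by (cases x; cases v) (auto simp: OT_cover_def real_directions_def)

lemma OT_translation_real: "OT_translation \<sigma> b \<in> real_directions"
  using embedding_real complex_is_Real_iff by (auto simp: OT_translation_def real_directions_def)

lemma OT_linear_real: "v \<in> real_directions \<Longrightarrow> OT_linear \<sigma> a v \<in> real_directions"
proof -
  have "Im (\<sigma> (Inl i) y) = 0" for y i using embedding_real complex_is_Real_iff by blast
  then show "v \<in> real_directions \<Longrightarrow> OT_linear \<sigma> a v \<in> real_directions"
    by (cases v) (auto simp: OT_linear_def real_directions_def)
qed

lemma OT_translation_add: "OT_translation \<sigma> (b + b') = OT_translation \<sigma> b + OT_translation \<sigma> b'"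
  by (simp add: OT_translation_def embedding_simps Finite_Cartesian_Product.vec_eq_iff)

lemma OT_translation_sum_int:
  "OT_translation \<sigma> (\<Sum>n\<in>N. of_int (d n) * b n) = (\<Sum>n\<in>N. of_int (d n) *\<^sub>R OT_translation \<sigma> (b n))"
proof (induction N rule: infinite_finite_induct)
  case (insert n N)
  have "OT_translation \<sigma> (of_int (d n) * b n) = of_int (d n) *\<^sub>R OT_translation \<sigma> (b n)"
    by (simp add: OT_translation_def embedding_simps Finite_Cartesian_Product.vec_eq_iff scaleR_conv_of_real[where 'a = complex])
  then show ?case using insert by (simp add: OT_translation_add)
qed (simp_all add: OT_translation_def embedding_simps Finite_Cartesian_Product.vec_eq_iff zero_prod_def)

text \<open>A real direction is a real combination of the translations by an integral basis.
  Splitting its coefficients into integer and fractional parts gives an integer translation and a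
  remainder from a compact parallelepiped.\<close>

lemma compact_fundamental_set:
  assumes S: "compact S" "S \<subseteq> OT_cover"
  obtains K where "compact K" "K \<subseteq> OT_cover"
    and "\<And>s v. s \<in> S \<Longrightarrow> v \<in> real_directions \<Longrightarrow>
      \<exists>k\<in>K. \<exists>b. algebraic_int b \<and> s + v = k + OT_translation \<sigma> b"
proof -
  obtain b :: "'s + ('t + 't) \<Rightarrow> 'k" where b: "\<And>n. algebraic_int (b n)"
    "\<And>x. \<exists>q::'s + ('t + 't) \<Rightarrow> rat. x = (\<Sum>n\<in>UNIV. of_rat (q n) * b n)"
    using integral_spanning by blast
  define comb :: "real ^ ('s + ('t + 't)) \<Rightarrow> ('s, 't) cover"
    where "comb c = (\<Sum>n\<in>UNIV. c $ n *\<^sub>R OT_translation \<sigma> (b n))" for c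
  define K where "K = (\<lambda>(s, c). s + comb c) ` (S \<times> cbox 0 1)"
  have "continuous_on UNIV comb" unfolding comb_def by (intro continuous_intros)
  then have "continuous_on (S \<times> cbox 0 1) (\<lambda>(s, c). s + comb c)"
    unfolding split_def
    by (intro continuous_on_add continuous_on_fst continuous_on_id
        continuous_on_compose2[of UNIV comb _ snd] continuous_on_snd) auto
  then have "compact K"
    unfolding K_def by (intro compact_continuous_image compact_Times S(1) compact_cbox)
  have comb_real: "comb c \<in> real_directions" for c
    unfolding comb_def
    by (intro subspace_sum subspace_real_directions subspace_scale OT_translation_real)
  then have "K \<subseteq> OT_cover" using S(2) by (auto simp: K_def OT_cover_add_real)
  have "\<exists>k\<in>K. \<exists>\<beta>. algebraic_int \<beta> \<and> s + v = k + OT_translation \<sigma> \<beta>"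
    if s: "s \<in> S" and v: "v \<in> real_directions" for s v
  proof -
    obtain c :: "'s + ('t + 't) \<Rightarrow> real"
      where c: "\<And>i. (\<Sum>n\<in>UNIV. of_real (c n) * \<sigma> (Inl i) (b n)) = of_real (Re (fst v $ i))"
        "\<And>j. (\<Sum>n\<in>UNIV. of_real (c n) * \<sigma> (Inr (Inl j)) (b n)) = snd v $ j"
      using integers_span_real[OF b(2), of "\<lambda>i. Re (fst v $ i)" "\<lambda>j. snd v $ j"] by blast
    have re: "of_real (Re (fst v $ i)) = fst v $ i" for i
      using v by (simp add: real_directions_def complex_eq_iff)
    have v_eq: "v = (\<Sum>n\<in>UNIV. c n *\<^sub>R OT_translation \<sigma> (b n))"
    proof (rule prod_eqI)
      show "fst v = fst (\<Sum>n\<in>UNIV. c n *\<^sub>R OT_translation \<sigma> (b n))"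
        using c(1) by (simp add: fst_sum Finite_Cartesian_Product.vec_eq_iff OT_translation_def scaleR_conv_of_real[where 'a = complex] re)
      show "snd v = snd (\<Sum>n\<in>UNIV. c n *\<^sub>R OT_translation \<sigma> (b n))"
        using c(2) by (simp add: snd_sum Finite_Cartesian_Product.vec_eq_iff OT_translation_def scaleR_conv_of_real[where 'a = complex])
    qed
    \<comment> \<open>The integer parts form an algebraic integer; the fractional parts lie in the
      unit cube.\<close>
    define \<beta> where "\<beta> = (\<Sum>n\<in>UNIV. of_int \<lfloor>c n\<rfloor> * b n)"
    have "algebraic_int \<beta>"
      unfolding \<beta>_def by (intro algebraic_int_sum algebraic_int_mult b(1) algebraic_int_of_int)
    have "v = comb (\<chi> n. frac (c n)) + OT_translation \<sigma> \<beta>"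
      unfolding v_eq comb_def \<beta>_def OT_translation_sum_int
      by (simp add: frac_def scaleR_left_diff_distrib sum_subtractf)
    then have eq: "s + v = (s + comb (\<chi> n. frac (c n))) + OT_translation \<sigma> \<beta>"
      by (simp add: add.assoc)
    have "(\<chi> n. frac (c n)) \<in> cbox 0 (1 :: real ^ ('s + ('t + 't)))"
      by (auto simp: mem_box_cart less_imp_le frac_lt_1)
    then have "s + comb (\<chi> n. frac (c n)) \<in> K" using s by (force simp: K_def)
    then show ?thesis using \<open>algebraic_int \<beta>\<close> eq by (intro bexI exI conjI)
  qed
  then show ?thesis using that \<open>compact K\<close> \<open>K \<subseteq> OT_cover\<close> by blast
qed

text \<open>By invariance, every value of \<open>h\<close> on \<open>S\<close> moved along the real
  directions is already taken on a compact subset of the cover.\<close>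

lemma translation_invariant_bound:
  fixes h :: "('s, 't) cover \<Rightarrow> real"
  assumes S: "compact S" "S \<subseteq> OT_cover" and h: "continuous_on OT_cover h"
    and inv: "\<And>x b. x \<in> OT_cover \<Longrightarrow> algebraic_int b \<Longrightarrow> h (x + OT_translation \<sigma> b) = h x"
  shows "\<exists>C. \<forall>s\<in>S. \<forall>v\<in>real_directions. \<bar>h (s + v)\<bar> \<le> C"
    and "(\<And>x. x \<in> OT_cover \<Longrightarrow> h x > 0) \<Longrightarrow> \<exists>m>0. \<forall>s\<in>S. \<forall>v\<in>real_directions. m \<le> h (s + v)"
proof -
  obtain K where K: "compact K" "K \<subseteq> OT_cover"
    and rep: "\<And>s v. s \<in> S \<Longrightarrow> v \<in> real_directions \<Longrightarrow>
      \<exists>k\<in>K. \<exists>b. algebraic_int b \<and> s + v = k + OT_translation \<sigma> b"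
    using compact_fundamental_set[OF S] by blast
  have red: "\<exists>k\<in>K. h (s + v) = h k" if sv: "s \<in> S" "v \<in> real_directions" for s v
  proof -
    obtain k b where "k \<in> K" "algebraic_int b" "s + v = k + OT_translation \<sigma> b"
      using rep[OF sv] by blast
    then show ?thesis using inv[of k b] K(2) by (intro bexI[of _ k]) auto
  qed
  have cK: "continuous_on K h" using h K(2) continuous_on_subset by blast
  have "bounded (h ` K)" by (intro compact_imp_bounded compact_continuous_image cK K(1))
  then obtain C where "\<And>k. k \<in> K \<Longrightarrow> \<bar>h k\<bar> \<le> C" unfolding bounded_iff by auto
  then show "\<exists>C. \<forall>s\<in>S. \<forall>v\<in>real_directions. \<bar>h (s + v)\<bar> \<le> C" using red by metis
  assume pos: "\<And>x. x \<in> OT_cover \<Longrightarrow> h x > 0"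
  show "\<exists>m>0. \<forall>s\<in>S. \<forall>v\<in>real_directions. m \<le> h (s + v)"
  proof (cases "K = {}")
    \<comment> \<open>The minimum below exists only on a nonempty set; an empty \<open>K\<close>
      means that \<open>S\<close> is empty too.\<close>
    case True
    then have "S = {}" using rep subspace_0[OF subspace_real_directions] by blast
    then show ?thesis by (intro exI[of _ 1]) auto
  next
    case False
    then obtain k0 where k0: "k0 \<in> K" "\<And>k. k \<in> K \<Longrightarrow> h k0 \<le> h k"
      using continuous_attains_inf[OF K(1) False cK] by blast
    then have "h k0 > 0" using pos K(2) by blast
    then show ?thesis using red k0(2) by metis
  qed
qed

end

section \<open>Taming forms\<close>

text \<open>When \<open>e'\<close> is the image of \<open>e\<close> under multiplication by the
  imaginary unit, the two arguments are the complex multiples of \<open>e\<close> and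
  \<open>e'\<close> by \<open>a + ib\<close>. The factor is the determinant of this multiplication
  on the real plane.\<close>

lemma alternating_rotation:
  assumes B: "bilinear B" and alt: "\<And>u. B u u = (0::real)"
  shows "B (a *\<^sub>R e + b *\<^sub>R e') (a *\<^sub>R e' - b *\<^sub>R e) = (a\<^sup>2 + b\<^sup>2) * B e e'"
proof -
  have "B (e + e') (e + e') = (B e e + B e e') + (B e' e + B e' e')"
    by (simp only: bilinear_ladd[OF B] bilinear_radd[OF B])
  then have "B e' e = - B e e'" by (simp add: alt)
  then show ?thesis
    by (simp add: bilinear_ladd[OF B] bilinear_rsub[OF B] bilinear_lmul[OF B] bilinear_rmul[OF B]
        alt algebra_simps power2_eq_square)
qed

lemma convex_OT_cover: "convex OT_cover"
proof (rule convexI)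
  fix x y :: "('a, 'b) cover" and s t :: real
  assume xy: "x \<in> OT_cover" "y \<in> OT_cover" and st: "0 \<le> s" "0 \<le> t" "s + t = 1"
  have "0 < s * Im (fst x $ i) + t * Im (fst y $ i)" for i
  proof (cases "s = 0")
    case False
    then show ?thesis
      using xy st by (intro add_pos_nonneg) (auto simp: OT_cover_def less_imp_le)
  qed (use xy st in \<open>auto simp: OT_cover_def\<close>)
  then show "s *\<^sub>R x + t *\<^sub>R y \<in> OT_cover"
    by (cases x; cases y) (simp add: OT_cover_def)
qed

section \<open>Comparison of two levels for a taming form\<close>

context OT_data
begin

text \<open>Chain rule. The set \<open>A\<close> allows one-sided derivatives at the ends of the
  unit interval as well as two-sided ones.\<close>

lemma pullback_along_curve:
  fixes \<gamma> :: "real \<Rightarrow> ('s, 't) cover"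
  assumes form: "differential_2_form (OT_manifold \<sigma> U) \<Omega>"
    and \<gamma>: "(\<gamma> has_vector_derivative k) (at s within A)" "\<gamma> s \<in> OT_cover"
  shows "((\<lambda>s. pullback \<Omega> (\<gamma> s) u v) has_real_derivative
    frechet_derivative (\<lambda>y. pullback \<Omega> y u v) (at (\<gamma> s)) k) (at s within A)"
proof -
  let ?D = "frechet_derivative (\<lambda>y. pullback \<Omega> y u v) (at (\<gamma> s))"
  have D: "((\<lambda>y. pullback \<Omega> y u v) has_derivative ?D) (at (\<gamma> s))"
    using pullback_C1(1)[OF form \<gamma>(2)] by (simp add: frechet_derivative_works)
  then have "linear ?D" by (rule has_derivative_linear)
  then have "(\<lambda>h. ?D (h *\<^sub>R k)) = (*) (?D k)"
    by (simp add: fun_eq_iff linear_cmul)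
  moreover have "((\<lambda>s. pullback \<Omega> (\<gamma> s) u v) has_derivative (\<lambda>h. ?D (h *\<^sub>R k))) (at s within A)"
    using has_derivative_compose[OF \<gamma>(1)[unfolded has_vector_derivative_def] D] .
  ultimately show ?thesis by (simp add: has_field_derivative_def)
qed

lemma no_taming_form:
  assumes symp: "symplectic_form (OT_manifold \<sigma> U) \<Omega>" and tame: "tames (OT_manifold \<sigma> U) \<Omega>"
  shows False
proof -
  have form: "differential_2_form (OT_manifold \<sigma> U) \<Omega>"
    using symp by (simp add: symplectic_form_def)
  define om where "om = pullback \<Omega>"
  obtain u j where u: "u \<in> U" "cmod (\<sigma> (Inr (Inl j)) u) > 1"
    using exists_expanding_unit by blast
  \<comment> \<open>The factor by which one application of the inverse of \<open>u\<close>
    multiplies the value of the form on the pair \<open>e\<close>, \<open>e'\<close>.\<close>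
  define c where "c = (cmod (\<sigma> (Inr (Inl j)) u))\<^sup>2"
  have "c > 1" using u(2) by (simp add: c_def)
  define e :: "('s, 't) cover" where "e = (0, axis j 1)"
  define e' :: "('s, 't) cover" where "e' = (0, axis j \<i>)"
  have real_e: "e \<in> real_directions" "e' \<in> real_directions"
    by (auto simp: real_directions_def e_def e'_def)
  have cont: "continuous_on OT_cover (\<lambda>x. om x v w)" for v w
    unfolding om_def using pullback_C1(1)[OF form] differentiable_imp_continuous_within
    by (blast intro: continuous_at_imp_continuous_on)
  have contD: "continuous_on OT_cover (\<lambda>x. frechet_derivative (\<lambda>y. om y v w) (at x) k)" for v w k
    unfolding om_def by (intro continuous_at_imp_continuous_on ballI pullback_C1(2)[OF form])
  have trans: "om (x + OT_translation \<sigma> b) v w = om x v w" if "x \<in> OT_cover" "algebraic_int b" for x b v w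
    using pullback_invariant[OF form that(1) U_one that(2), of v w]
    by (simp add: om_def OT_action_eq OT_linear_1)
  have pos: "om x e e' > 0" if "x \<in> OT_cover" for x
  proof -
    have "e \<noteq> 0" by (simp add: e_def axis_def Finite_Cartesian_Product.vec_eq_iff zero_prod_def)
    moreover have "model_J (OT_manifold \<sigma> U) e = e'"
      by (auto simp: OT_manifold_def e_def e'_def axis_def Finite_Cartesian_Product.vec_eq_iff)
    ultimately show ?thesis using pullback_tamed[OF form tame that, of e] by (simp add: om_def)
  qed
  \<comment> \<open>On the plane of \<open>e\<close> and \<open>e'\<close> the action of
    \<open>a\<close> is multiplication by its value at the chosen complex embedding, so invariance
    of the form yields the square of the absolute value as a factor.\<close>
  have scale: "om (OT_linear \<sigma> a x) e e' * (cmod (\<sigma> (Inr (Inl j)) a))\<^sup>2 = om x e e'"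
    if x: "x \<in> OT_cover" and a: "a \<in> U" for x a
  proof -
    let ?z = "\<sigma> (Inr (Inl j)) a"
    have act: "OT_action \<sigma> (a, 0) x = OT_linear \<sigma> a x"
      by (simp add: OT_action_eq OT_translation_def embedding_simps Finite_Cartesian_Product.vec_eq_iff zero_prod_def[symmetric] flip: Finite_Cartesian_Product.zero_vec_def)
    have "OT_linear \<sigma> a e = Re ?z *\<^sub>R e + Im ?z *\<^sub>R e'" "OT_linear \<sigma> a e' = Re ?z *\<^sub>R e' - Im ?z *\<^sub>R e"
      by (auto simp: OT_linear_def e_def e'_def axis_def Finite_Cartesian_Product.vec_eq_iff complex_eq_iff)
    moreover have cov: "OT_linear \<sigma> a x \<in> OT_cover" using OT_action_cover[OF x a, of 0] act by simp
    ultimately show ?thesis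
      using pullback_invariant[OF form x a, of 0 e e']
        alternating_rotation[OF pullback_bilinear(1)[OF form cov] pullback_bilinear(2)[OF form cov]]
      by (simp add: om_def act cmod_power2 mult.commute)
  qed
  define x0 :: "('s, 't) cover" where "x0 = ((\<chi> i. \<i>), 0)"
  have x0: "x0 \<in> OT_cover" by (simp add: x0_def OT_cover_def)
  have S0: "compact {x0}" "{x0} \<subseteq> OT_cover" using x0 by simp_all
  obtain M where M: "\<And>v. v \<in> real_directions \<Longrightarrow> \<bar>om (x0 + v) e e'\<bar> \<le> M"
    using translation_invariant_bound(1)[OF S0 cont[of e e']] trans by blast
  obtain m where m: "m > 0" "\<And>v. v \<in> real_directions \<Longrightarrow> m \<le> om (x0 + v) e e'"
    using translation_invariant_bound(2)[OF S0 cont[of e e']] trans pos by blast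
  \<comment> \<open>This makes the lower bound \<open>m * c ^ N\<close> on the level of
    \<open>x1\<close> exceed the upper bound \<open>M\<close> on the level of
    \<open>x0\<close>.\<close>
  obtain N where N: "M / m < c ^ N" using real_arch_pow[OF \<open>c > 1\<close>] by blast
  define a where "a = inverse u ^ N"
  have a: "a \<in> U" unfolding a_def by (intro U_power U_inverse u(1))
  have ca: "(cmod (\<sigma> (Inr (Inl j)) a))\<^sup>2 * c ^ N = 1"
  proof -
    have "c ^ N = (cmod (\<sigma> (Inr (Inl j)) u) ^ N)\<^sup>2"
      unfolding c_def by (simp only: power_mult[symmetric] mult.commute)
    moreover have "cmod (\<sigma> (Inr (Inl j)) a) = inverse (cmod (\<sigma> (Inr (Inl j)) u) ^ N)"
      by (simp add: a_def embedding_simps norm_power norm_inverse power_inverse)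
    moreover have "cmod (\<sigma> (Inr (Inl j)) u) ^ N \<noteq> 0" using u(2) by auto
    ultimately show ?thesis by (simp add: power_inverse)
  qed
  define x1 where "x1 = OT_linear \<sigma> a x0"
  have x1: "x1 \<in> OT_cover"
    using OT_action_cover[OF x0 a, of 0]
    by (simp add: x1_def OT_action_eq OT_translation_def embedding_simps zero_prod_def[symmetric] flip: Finite_Cartesian_Product.zero_vec_def)
  \<comment> \<open>Every point of the level of \<open>x1\<close> is the image under
    \<open>a\<close> of a point of the level of \<open>x0\<close>; the direction \<open>v\<close> is
    carried back by the inverse of \<open>a\<close>.\<close>
  have low: "m * c ^ N \<le> om (x1 + v) e e'" if v: "v \<in> real_directions" for v
  proof -
    let ?v = "OT_linear \<sigma> (inverse a) v"
    have v': "?v \<in> real_directions" by (rule OT_linear_real[OF v])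
    have "OT_linear \<sigma> a (x0 + ?v) = x1 + v"
      using U_nonzero[OF a] unfolding x1_def
      by (cases v) (simp add: OT_linear_def x0_def Finite_Cartesian_Product.vec_eq_iff algebra_simps
          embedding_simps)
    then have "om (x1 + v) e e' * (cmod (\<sigma> (Inr (Inl j)) a))\<^sup>2 = om (x0 + ?v) e e'"
      using scale[OF _ a, of "x0 + ?v"] x0 v' OT_cover_add_real by simp
    then have "om (x1 + v) e e' * ((cmod (\<sigma> (Inr (Inl j)) a))\<^sup>2 * c ^ N) = om (x0 + ?v) e e' * c ^ N"
      by simp
    then have "om (x1 + v) e e' = om (x0 + ?v) e e' * c ^ N" by (simp add: ca)
    then show ?thesis using m(2)[OF v'] \<open>c > 1\<close> by (simp add: mult_right_mono)
  qed
  \<comment> \<open>The two levels are joined by the segment from \<open>x0\<close> to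
    \<open>x1\<close>, which stays in the cover by convexity.\<close>
  define \<nu> where "\<nu> = x1 - x0"
  define S where "S = (\<lambda>t. x0 + t *\<^sub>R \<nu>) ` {0..1}"
  have "compact S" unfolding S_def by (intro compact_continuous_image continuous_intros) simp
  have S: "x0 + t *\<^sub>R \<nu> \<in> S" if "t \<in> {0..1}" for t using that by (auto simp: S_def)
  have "S \<subseteq> OT_cover"
  proof -
    have "x0 + t *\<^sub>R \<nu> = (1 - t) *\<^sub>R x0 + t *\<^sub>R x1" for t by (simp add: \<nu>_def algebra_simps)
    then show ?thesis
      using convexD[OF convex_OT_cover x0 x1] by (auto simp: S_def)
  qed
  obtain C1 where C1: "\<And>s v. s \<in> S \<Longrightarrow> v \<in> real_directions \<Longrightarrow> \<bar>om (s + v) \<nu> e'\<bar> \<le> C1"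
    using translation_invariant_bound(1)[OF \<open>compact S\<close> \<open>S \<subseteq> OT_cover\<close> cont[of \<nu> e']] trans by blast
  obtain C2 where C2: "\<And>s v. s \<in> S \<Longrightarrow> v \<in> real_directions \<Longrightarrow> \<bar>om (s + v) \<nu> e\<bar> \<le> C2"
    using translation_invariant_bound(1)[OF \<open>compact S\<close> \<open>S \<subseteq> OT_cover\<close> cont[of \<nu> e]] trans by blast
  define V where "V y = fst y *\<^sub>R e + snd y *\<^sub>R e'" for y :: "real \<times> real"
  have V: "V y \<in> real_directions" for y
    unfolding V_def by (intro subspace_add subspace_scale subspace_real_directions real_e)
  \<comment> \<open>The parameter \<open>t\<close> moves between the levels, while \<open>y\<close>
    runs through the plane of \<open>e\<close> and \<open>e'\<close>.\<close>
  define P where "P t y = x0 + t *\<^sub>R \<nu> + V y" for t y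
  have P: "P t y \<in> OT_cover" if "t \<in> {0..1}" for t y
    using S[OF that] \<open>S \<subseteq> OT_cover\<close> OT_cover_add_real[OF V] unfolding P_def by blast
  have contP: "continuous_on A (\<lambda>(t, y). P t y)" for A
    unfolding P_def V_def split_def by (intro continuous_intros)
  have contPt: "continuous_on A (P t)" for A t
    unfolding P_def V_def by (intro continuous_intros)
  have "m * c ^ N \<le> M"
  proof (rule flux_estimate[where
        f = "\<lambda>t y. om (P t y) e e'" and
        p = "\<lambda>t y. om (P t y) \<nu> e'" and
        q = "\<lambda>t y. om (P t y) \<nu> e" and
        p' = "\<lambda>t y. frechet_derivative (\<lambda>x. om x \<nu> e') (at (P t y)) e" and
        q' = "\<lambda>t y. frechet_derivative (\<lambda>x. om x \<nu> e) (at (P t y)) e'" and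
        C = "max C1 C2"])
    fix t y assume t: "t \<in> {0..1::real}"
    \<comment> \<open>Closedness on the constant fields \<open>\<nu>\<close>, \<open>e\<close>,
      \<open>e'\<close> expresses the derivative of the density along the segment as a divergence in
      the plane.\<close>
    have "ext_deriv2 om (P t y) \<nu> e e' = 0"
      unfolding om_def using symp P[OF t] by (rule pullback_closed)
    then have closed: "frechet_derivative (\<lambda>x. om x \<nu> e') (at (P t y)) e - frechet_derivative (\<lambda>x. om x \<nu> e) (at (P t y)) e'
      = frechet_derivative (\<lambda>x. om x e e') (at (P t y)) \<nu>"
      by (simp add: ext_deriv2_def)
    have "((\<lambda>t. P t y) has_vector_derivative \<nu>) (at t within {0..1})"
      unfolding P_def by (auto intro!: derivative_eq_intros)
    then show "((\<lambda>t. om (P t y) e e') has_real_derivative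
        frechet_derivative (\<lambda>x. om x \<nu> e') (at (P t y)) e - frechet_derivative (\<lambda>x. om x \<nu> e) (at (P t y)) e')
        (at t within {0..1})"
      unfolding closed unfolding om_def using P[OF t] by (rule pullback_along_curve[OF form])
  next
    fix t a b assume t: "t \<in> {0..1::real}"
    have "((\<lambda>a. P t (a, b)) has_vector_derivative e) (at a)"
      unfolding P_def V_def by (auto intro!: derivative_eq_intros)
    then show "((\<lambda>a. om (P t (a, b)) \<nu> e') has_real_derivative
        frechet_derivative (\<lambda>x. om x \<nu> e') (at (P t (a, b))) e) (at a)"
      unfolding om_def using P[OF t] by (rule pullback_along_curve[OF form])
    have "((\<lambda>b. P t (a, b)) has_vector_derivative e') (at b)"
      unfolding P_def V_def by (auto intro!: derivative_eq_intros)
    then show "((\<lambda>b. om (P t (a, b)) \<nu> e) has_real_derivative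
        frechet_derivative (\<lambda>x. om x \<nu> e) (at (P t (a, b))) e') (at b)"
      unfolding om_def using P[OF t] by (rule pullback_along_curve[OF form])
  next
    fix t assume t: "t \<in> {0..1::real}"
    have "continuous_on UNIV (\<lambda>y. om (P t y) v w)" for v w
      using continuous_on_compose2[OF cont contPt] P[OF t] by blast
    then show "continuous_on UNIV (\<lambda>y. om (P t y) e e')" "continuous_on UNIV (\<lambda>y. om (P t y) \<nu> e')"
      "continuous_on UNIV (\<lambda>y. om (P t y) \<nu> e)" by blast+
  next
    have "continuous_on ({0..1} \<times> UNIV) (\<lambda>z. frechet_derivative (\<lambda>x. om x v w) (at (case z of (t, y) \<Rightarrow> P t y)) k)"
      for v w k
      by (rule continuous_on_compose2[OF contD contP]) (use P in auto)
    then show "continuous_on ({0..1} \<times> UNIV) (\<lambda>(t, y). frechet_derivative (\<lambda>x. om x \<nu> e') (at (P t y)) e)"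
      "continuous_on ({0..1} \<times> UNIV) (\<lambda>(t, y). frechet_derivative (\<lambda>x. om x \<nu> e) (at (P t y)) e')"
      by (simp_all add: split_def)
  next
    fix t y assume t: "t \<in> {0..1::real}"
    show "\<bar>om (P t y) \<nu> e'\<bar> \<le> max C1 C2" "\<bar>om (P t y) \<nu> e\<bar> \<le> max C1 C2"
      unfolding P_def using C1[OF S[OF t] V] C2[OF S[OF t] V] by (auto simp: le_max_iff_disj)
  next
    fix y
    show "om (P 0 y) e e' \<le> M" using M[OF V, of y] by (simp add: P_def)
    show "m * c ^ N \<le> om (P 1 y) e e'" using low[OF V, of y] by (simp add: P_def \<nu>_def)
  qed
  then show False using N m(1) by (simp add: field_simps)
qed

end

theorem mainTheorem5:
  fixes \<sigma> :: "'s::finite + ('t::finite + 't) \<Rightarrow> 'k::field_char_0 \<Rightarrow> complex"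
    and U :: "'k set"
  assumes "number_field_embeddings \<sigma>"
    and "admissible_units \<sigma> U"
  shows "\<not> (\<exists>\<Omega>. symplectic_form (OT_manifold \<sigma> U) \<Omega> \<and> tames (OT_manifold \<sigma> U) \<Omega>)"
proof -
  interpret OT_data \<sigma> U
    by unfold_locales (use assms in auto)
  show ?thesis using no_taming_form by blast
qed

end
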